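(* Let $w=w(a,b)$ be a reduced word in the free group $F_2$ with basis $a,b$. Then the operation $x*_w y=w(x,y)$ defines a group operation on $F_n/\gamma_k(F_n)$ for all $n\ge 2$ and $k\ge 1$ if and only if $w=ab$ or $w=ba$.
   Context: $F_n$ is the free group of rank $n$, and $\gamma_1(G)=G$, $\gamma_{k+1}(G)=[\gamma_k(G),G]$ is the lower central series of a group $G$. For a group $G$ and $x,y\in G$, $w(x,y)$ is the image of $w$ under the homomorphism $F_2\to G$ with $a\mapsto x$, $b\mapsto y$. "Defines a group operation" means that the underlying set with the operation $*_w$ is a group. *)

theory Defs
  imports "HOL-Algebra.Algebra"
begin

section \<open>Free groups of finite rank\<close>

text \<open>
  A letter \<open>(i, True)\<close> stands for the generator \<open>x\<^sub>i\<close>, a letter \<open>(i, False)\<close> for its inverse.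
  The elements of the free group are the reduced words, and the product of two of them is the
  reduced form of their concatenation.
\<close>

type_synonym letter = "nat \<times> bool"

definition letter_inv :: "letter \<Rightarrow> letter" where
  "letter_inv x = (fst x, \<not> snd x)"

definition reduced :: "letter list \<Rightarrow> bool" where
  "reduced = successively (\<lambda>x y. y \<noteq> letter_inv x)"

definition push :: "letter \<Rightarrow> letter list \<Rightarrow> letter list" where
  "push x ys = (if ys \<noteq> [] \<and> hd ys = letter_inv x then tl ys else x # ys)"

definition reduce :: "letter list \<Rightarrow> letter list" where
  "reduce xs = foldr push xs []"

definition free_group :: "nat \<Rightarrow> letter list monoid" where
  "free_group n =
     \<lparr>carrier = {xs. reduced xs \<and> fst ` set xs \<subseteq> {..<n}},
      monoid.mult = (\<lambda>xs ys. reduce (xs @ ys)),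
      one = []\<rparr>"

definition gen :: "nat \<Rightarrow> letter list" where
  "gen i = [(i, True)]"

lemma letter_inv_letter_inv [simp]: "letter_inv (letter_inv x) = x"
  by (simp add: letter_inv_def)

lemma letter_inv_neq [simp]: "letter_inv x \<noteq> x"
  by (cases x) (simp add: letter_inv_def)

lemma reduced_Nil [simp]: "reduced []"
  by (simp add: reduced_def)

lemma reduced_Cons: "reduced (x # xs) \<longleftrightarrow> (xs = [] \<or> hd xs \<noteq> letter_inv x) \<and> reduced xs"
  by (auto simp: reduced_def successively_Cons)

lemma reduced_push: "reduced ys \<Longrightarrow> reduced (push x ys)"
  by (cases ys) (auto simp: push_def reduced_Cons)

lemma reduced_foldr_push: "reduced ys \<Longrightarrow> reduced (foldr push xs ys)"
  by (induction xs) (auto intro: reduced_push)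

lemma push_push_inv: "reduced ys \<Longrightarrow> push x (push (letter_inv x) ys) = ys"
  by (cases ys) (auto simp: push_def reduced_Cons)

lemma foldr_push_push:
  assumes "reduced zs"
  shows "foldr push (push x ys) zs = push x (foldr push ys zs)"
proof (cases "ys \<noteq> [] \<and> hd ys = letter_inv x")
  case True
  then obtain ys' where "ys = letter_inv x # ys'"
    by (cases ys) auto
  then show ?thesis
    using push_push_inv[OF reduced_foldr_push[OF assms]] by (simp add: push_def[of x "letter_inv x # ys'"])
qed (auto simp: push_def[of x ys])

lemma foldr_push_foldr_push:
  "reduced zs \<Longrightarrow> foldr push (foldr push xs ys) zs = foldr push xs (foldr push ys zs)"
  by (induction xs) (simp_all add: foldr_push_push)

lemma reduce_reduced: "reduced xs \<Longrightarrow> reduce xs = xs"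
  by (induction xs) (auto simp: reduce_def reduced_Cons push_def)

lemma reduce_append: "reduced ys \<Longrightarrow> reduce (xs @ ys) = foldr push xs ys"
  using reduce_reduced[of ys] by (simp add: reduce_def)

lemma foldr_push_inverse:
  "reduced ys \<Longrightarrow> foldr push (rev (map letter_inv xs)) (foldr push xs ys) = ys"
proof (induction xs)
  case (Cons x xs)
  then show ?case
    using push_push_inv[of "foldr push xs ys" "letter_inv x"] by (simp add: reduced_foldr_push)
qed simp

lemma set_push: "set (push x ys) \<subseteq> insert x (set ys)"
  by (cases ys) (auto simp: push_def)

lemma set_foldr_push: "set (foldr push xs ys) \<subseteq> set xs \<union> set ys"
proof (induction xs)
  case (Cons x xs)
  then show ?case using set_push[of x "foldr push xs ys"] by auto
qed simp

lemma reduced_rev_inverse: "reduced xs \<Longrightarrow> reduced (rev (map letter_inv xs))"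
proof -
  assume "reduced xs"
  then have "successively (\<lambda>x y. letter_inv x \<noteq> y) xs"
    unfolding reduced_def by (rule successively_mono) auto
  then show ?thesis
    unfolding reduced_def by (simp add: successively_map)
qed

lemma carrier_free_group:
  "xs \<in> carrier (free_group n) \<longleftrightarrow> reduced xs \<and> fst ` set xs \<subseteq> {..<n}"
  by (simp add: free_group_def)

lemma one_free_group [simp]: "\<one>\<^bsub>free_group n\<^esub> = []"
  by (simp add: free_group_def)

lemma mult_free_group:
  "ys \<in> carrier (free_group n) \<Longrightarrow> xs \<otimes>\<^bsub>free_group n\<^esub> ys = foldr push xs ys"
  by (simp add: free_group_def reduce_append)

lemma gen_in_carrier: "i < n \<Longrightarrow> gen i \<in> carrier (free_group n)"
  by (simp add: carrier_free_group gen_def reduced_Cons)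

lemma foldr_push_closed:
  assumes "xs \<in> carrier (free_group n)" "ys \<in> carrier (free_group n)"
  shows "foldr push xs ys \<in> carrier (free_group n)"
  using assms set_foldr_push[of xs ys] by (force simp: carrier_free_group reduced_foldr_push)

lemma group_free_group: "group (free_group n)"
proof (rule groupI)
  fix xs ys zs
  assume xs: "xs \<in> carrier (free_group n)" and ys: "ys \<in> carrier (free_group n)"
  then show "xs \<otimes>\<^bsub>free_group n\<^esub> ys \<in> carrier (free_group n)"
    by (simp add: mult_free_group foldr_push_closed)
  assume "zs \<in> carrier (free_group n)"
  with xs ys show "xs \<otimes>\<^bsub>free_group n\<^esub> ys \<otimes>\<^bsub>free_group n\<^esub> zs =
      xs \<otimes>\<^bsub>free_group n\<^esub> (ys \<otimes>\<^bsub>free_group n\<^esub> zs)"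
    using foldr_push_foldr_push[of zs xs ys]
    by (simp add: mult_free_group foldr_push_closed) (simp add: carrier_free_group)
next
  fix xs assume xs: "xs \<in> carrier (free_group n)"
  then show "\<one>\<^bsub>free_group n\<^esub> \<otimes>\<^bsub>free_group n\<^esub> xs = xs"
    by (simp add: mult_free_group)
  have "rev (map letter_inv xs) \<in> carrier (free_group n)"
    using xs by (auto simp: carrier_free_group reduced_rev_inverse letter_inv_def)
  moreover have "foldr push (rev (map letter_inv xs)) xs = []"
    using foldr_push_inverse[of "[]" xs] xs reduce_reduced[of xs]
    by (simp add: carrier_free_group reduce_def)
  ultimately show "\<exists>ys\<in>carrier (free_group n). ys \<otimes>\<^bsub>free_group n\<^esub> xs = \<one>\<^bsub>free_group n\<^esub>"
    using xs by (auto simp: mult_free_group)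
qed (simp add: carrier_free_group)


section \<open>Values of words\<close>

definition letter_val :: "('a, 'c) monoid_scheme \<Rightarrow> (nat \<Rightarrow> 'a) \<Rightarrow> letter \<Rightarrow> 'a" where
  "letter_val G f x = (if snd x then f (fst x) else inv\<^bsub>G\<^esub> f (fst x))"

definition word_val :: "('a, 'c) monoid_scheme \<Rightarrow> (nat \<Rightarrow> 'a) \<Rightarrow> letter list \<Rightarrow> 'a" where
  "word_val G f w = foldr (\<lambda>x g. letter_val G f x \<otimes>\<^bsub>G\<^esub> g) w \<one>\<^bsub>G\<^esub>"

text \<open>
  The basis \<open>a, b\<close> of \<open>free_group 2\<close> is \<open>gen 0, gen 1\<close>. The lemmas \<open>word_val2_hom\<close> and
  \<open>word_val2_unique\<close> below show that \<open>w \<mapsto> w(x, y)\<close> is the unique homomorphism from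
  \<open>free_group 2\<close> with \<open>a \<mapsto> x\<close> and \<open>b \<mapsto> y\<close>.
\<close>

definition word_val2 :: "('a, 'c) monoid_scheme \<Rightarrow> letter list \<Rightarrow> 'a \<Rightarrow> 'a \<Rightarrow> 'a" where
  "word_val2 G w x y = word_val G (\<lambda>i. if i = 0 then x else y) w"

context group
begin

lemma word_val_Nil [simp]: "word_val G f [] = \<one>"
  by (simp add: word_val_def)

lemma word_val_Cons [simp]: "word_val G f (x # xs) = letter_val G f x \<otimes> word_val G f xs"
  by (simp add: word_val_def)

lemma letter_val_closed: "f (fst x) \<in> carrier G \<Longrightarrow> letter_val G f x \<in> carrier G"
  by (simp add: letter_val_def)

lemma letter_val_inv:
  "f (fst x) \<in> carrier G \<Longrightarrow> letter_val G f (letter_inv x) = inv (letter_val G f x)"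
  by (simp add: letter_val_def letter_inv_def)

lemma word_val_closed: "f ` fst ` set w \<subseteq> carrier G \<Longrightarrow> word_val G f w \<in> carrier G"
  by (induction w) (auto intro: letter_val_closed)

lemma word_val_push:
  assumes "f (fst x) \<in> carrier G" "f ` fst ` set ys \<subseteq> carrier G"
  shows "word_val G f (push x ys) = letter_val G f x \<otimes> word_val G f ys"
proof (cases "ys \<noteq> [] \<and> hd ys = letter_inv x")
  case True
  then obtain ys' where ys: "ys = letter_inv x # ys'"
    by (cases ys) auto
  with assms have "word_val G f ys' \<in> carrier G"
    by (auto intro!: word_val_closed)
  with ys assms letter_val_closed[of f x] show ?thesis
    by (simp add: push_def letter_val_inv m_assoc[symmetric])
qed (auto simp: push_def)

lemma word_val_foldr_push:
  assumes "f ` fst ` set xs \<subseteq> carrier G" "f ` fst ` set ys \<subseteq> carrier G"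
  shows "word_val G f (foldr push xs ys) = word_val G f xs \<otimes> word_val G f ys"
  using assms(1)
proof (induction xs)
  case Nil
  then show ?case using assms(2) by (simp add: word_val_closed)
next
  case (Cons x xs)
  have "f ` fst ` set (foldr push xs ys) \<subseteq> f ` fst ` (set xs \<union> set ys)"
    by (intro image_mono set_foldr_push)
  also have "\<dots> \<subseteq> carrier G"
    using Cons.prems assms(2) by (simp add: image_Un)
  finally have "f ` fst ` set (foldr push xs ys) \<subseteq> carrier G" .
  then show ?case
    using Cons assms(2)
    by (simp add: word_val_push m_assoc letter_val_closed word_val_closed)
qed

lemma word_val_hom:
  assumes "f ` {..<n} \<subseteq> carrier G"
  shows "word_val G f \<in> hom (free_group n) G"
proof (rule homI)
  have *: "f ` fst ` set xs \<subseteq> carrier G" if "xs \<in> carrier (free_group n)" for xs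
    using that assms by (force simp: carrier_free_group)
  fix xs ys
  assume xs: "xs \<in> carrier (free_group n)"
  then show "word_val G f xs \<in> carrier G"
    by (intro word_val_closed *)
  assume "ys \<in> carrier (free_group n)"
  with xs show "word_val G f (xs \<otimes>\<^bsub>free_group n\<^esub> ys) = word_val G f xs \<otimes> word_val G f ys"
    by (simp add: mult_free_group word_val_foldr_push *)
qed

lemma word_val_unique:
  assumes h: "h \<in> hom (free_group n) G" and f: "\<And>i. i < n \<Longrightarrow> h (gen i) = f i"
    and "w \<in> carrier (free_group n)"
  shows "h w = word_val G f w"
proof -
  interpret h: group_hom "free_group n" G h
    using h group_free_group by (simp add: group_hom_def group_hom_axioms_def is_group)
  have letter: "[x] \<in> carrier (free_group n) \<and> h [x] = letter_val G f x" if "fst x < n" for x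
  proof (cases "snd x")
    case True
    then have "[x] = gen (fst x)"
      by (cases x) (simp add: gen_def)
    with that True show ?thesis
      by (simp add: f gen_in_carrier letter_val_def)
  next
    case False
    then obtain i where x: "x = (i, False)"
      by (cases x) simp
    have c: "[x] \<in> carrier (free_group n)" "gen i \<in> carrier (free_group n)"
      using that x by (auto simp: carrier_free_group reduced_Cons gen_def)
    have "[x] \<otimes>\<^bsub>free_group n\<^esub> gen i = \<one>\<^bsub>free_group n\<^esub>"
      using c by (simp add: mult_free_group x gen_def push_def letter_inv_def)
    then have "h [x] \<otimes> h (gen i) = \<one>"
      using c h.hom_mult[of "[x]" "gen i"] h.hom_one by simp
    then have "h [x] = inv (h (gen i))"
      using c by (intro inv_equality[symmetric]) simp_all
    with c that x f show ?thesis by (simp add: letter_val_def)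
  qed
  from assms(3) show ?thesis
  proof (induction w)
    case Nil
    then show ?case using h.hom_one by simp
  next
    case (Cons x xs)
    then have xs: "xs \<in> carrier (free_group n)" and x: "fst x < n"
      by (auto simp: carrier_free_group reduced_Cons)
    have "x # xs = [x] \<otimes>\<^bsub>free_group n\<^esub> xs"
      using Cons.prems xs by (auto simp: mult_free_group push_def carrier_free_group reduced_Cons)
    then have "h (x # xs) = h [x] \<otimes> h xs"
      using letter[OF x] h.hom_mult[of "[x]" xs] xs by simp
    then show ?case
      using Cons.IH[OF xs] letter[OF x] by simp
  qed
qed

lemma word_val2_hom:
  assumes "x \<in> carrier G" "y \<in> carrier G"
  shows "(\<lambda>w. word_val2 G w x y) \<in> hom (free_group 2) G"
    and "word_val2 G (gen 0) x y = x" and "word_val2 G (gen 1) x y = y"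
  using assms word_val_hom[of "\<lambda>i. if i = 0 then x else y" 2]
  by (auto simp: word_val2_def gen_def letter_val_def)

lemma word_val2_unique:
  assumes "h \<in> hom (free_group 2) G" "h (gen 0) = x" "h (gen 1) = y"
    and "w \<in> carrier (free_group 2)"
  shows "h w = word_val2 G w x y"
  unfolding word_val2_def
  using assms by (intro word_val_unique[where n = 2]) (auto simp: less_2_cases_iff)

end


section \<open>Lower central series\<close>

definition commutator_subgroup :: "('a, 'c) monoid_scheme \<Rightarrow> 'a set \<Rightarrow> 'a set \<Rightarrow> 'a set" where
  "commutator_subgroup G H K =
     generate G (\<Union>h\<in>H. \<Union>k\<in>K. {h \<otimes>\<^bsub>G\<^esub> k \<otimes>\<^bsub>G\<^esub> inv\<^bsub>G\<^esub> h \<otimes>\<^bsub>G\<^esub> inv\<^bsub>G\<^esub> k})"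

text \<open>The series starts at index 1; the value at 0 is a dummy.\<close>

fun lower_central :: "('a, 'c) monoid_scheme \<Rightarrow> nat \<Rightarrow> 'a set" where
  "lower_central G 0 = carrier G"
| "lower_central G (Suc 0) = carrier G"
| "lower_central G (Suc (Suc k)) = commutator_subgroup G (lower_central G (Suc k)) (carrier G)"

lemma (in group) normal_commutator_subgroup:
  assumes "H \<lhd> G"
  shows "commutator_subgroup G H (carrier G) \<lhd> G"
  unfolding commutator_subgroup_def
proof (rule normal_generateI)
  interpret H: normal H G by fact
  show "(\<Union>h\<in>H. \<Union>k\<in>carrier G. {h \<otimes> k \<otimes> inv h \<otimes> inv k}) \<subseteq> carrier G"
    by auto
  fix c g
  assume "c \<in> (\<Union>h\<in>H. \<Union>k\<in>carrier G. {h \<otimes> k \<otimes> inv h \<otimes> inv k})" and g: "g \<in> carrier G"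
  then obtain h k where h: "h \<in> H" and k: "k \<in> carrier G"
    and c: "c = h \<otimes> k \<otimes> inv h \<otimes> inv k"
    by auto
  have hG: "h \<in> carrier G" using h by (rule H.mem_carrier)
  define h' k' where "h' = g \<otimes> h \<otimes> inv g" and "k' = g \<otimes> k \<otimes> inv g"
  have "h' \<in> H" "k' \<in> carrier G"
    using h g k H.inv_op_closed2 by (auto simp: h'_def k'_def)
  moreover have "inv g \<otimes> (g \<otimes> z) = z" if "z \<in> carrier G" for z
    using g that by (simp add: m_assoc[symmetric])
  then have "g \<otimes> c \<otimes> inv g = h' \<otimes> k' \<otimes> inv h' \<otimes> inv k'"
    unfolding h'_def k'_def c using g hG k
    by (simp add: m_assoc inv_mult_group)
  ultimately show "g \<otimes> c \<otimes> inv g \<in> (\<Union>h\<in>H. \<Union>k\<in>carrier G. {h \<otimes> k \<otimes> inv h \<otimes> inv k})"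
    by blast
qed

lemma (in group) normal_lower_central: "lower_central G k \<lhd> G"
proof (induction k rule: induct_nat_012)
  case (ge2 k)
  then show ?case by (simp add: normal_commutator_subgroup)
qed (simp_all add: normal_self)


section \<open>Words defining group operations\<close>

definition defines_group_operation :: "letter list \<Rightarrow> ('a, 'c) monoid_scheme \<Rightarrow> bool" where
  "defines_group_operation w G \<longleftrightarrow>
     (\<exists>e. group \<lparr>carrier = carrier G, monoid.mult = word_val2 G w, one = e\<rparr>)"

end

theory Submission
  imports Defs "HOL-Library.Sublist" "HOL-Library.Function_Algebras"
begin

text \<open>
  If \<open>w\<close> defines a group operation on all the quotients, then it is associative on \<open>F\<^sub>3\<close> by
  residual nilpotence, and the neutral element of \<open>F\<^sub>3/\<gamma>\<^sub>2(F\<^sub>3)\<close> shows that both exponent sums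
  of \<open>w\<close> are 1. Up to exchanging \<open>a\<close> and \<open>b\<close>, \<open>w\<close> starts with a maximal power \<open>a\<^sup>p\<close>, \<open>p \<noteq> 0\<close>.
  Comparing what precedes the first \<open>c\<^sup>\<plusminus>\<^sup>1\<close> in \<open>w(w(a,b),c) = w(a,w(b,c))\<close> gives
  \<open>w\<^sup>p = a\<^sup>p b\<^sup>s\<close>. Under \<open>a \<mapsto> (x \<mapsto> x + 1)\<close>, \<open>b \<mapsto> (x \<mapsto> 2 x)\<close> this forces \<open>2\<^bsup>|p|\<^esup> - 1\<close> to
  divide \<open>p\<close>, so \<open>p = \<plusminus>1\<close>.
\<close>

section \<open>Actions of free groups\<close>

text \<open>Deleting a cancelling pair of letters leaves the composite map unchanged. Hence
  letterwise maps with \<open>A x\<close> inverse to \<open>A (letter_inv x)\<close> extend to an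
  action of the free group, as used below for \<open>magnus\<close> and
  \<open>affine\<close>.\<close>

lemma foldr_action_push:
  assumes "\<And>x s. A x (A (letter_inv x) s) = s"
  shows "foldr A (push x ys) s = A x (foldr A ys s)"
proof (cases "ys \<noteq> [] \<and> hd ys = letter_inv x")
  case True
  then obtain ys' where "ys = letter_inv x # ys'"
    by (cases ys) auto
  with assms show ?thesis
    by (simp add: push_def)
qed (auto simp: push_def)

lemma foldr_action_foldr_push:
  assumes "\<And>x s. A x (A (letter_inv x) s) = s"
  shows "foldr A (foldr push xs ys) s = foldr A xs (foldr A ys s)"
  by (induction xs) (simp_all add: foldr_action_push[of A, OF assms])

lemma foldr_action_mult:
  assumes "\<And>x s. A x (A (letter_inv x) s) = s" "ys \<in> carrier (free_group n)"
  shows "foldr A (xs \<otimes>\<^bsub>free_group n\<^esub> ys) s = foldr A xs (foldr A ys s)"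
  using assms by (simp add: mult_free_group foldr_action_foldr_push[of A])

lemma foldr_action_inv:
  assumes "\<And>x s. A x (A (letter_inv x) s) = s" "xs \<in> carrier (free_group n)"
  shows "foldr A xs (foldr A (inv\<^bsub>free_group n\<^esub> xs) s) = s"
proof -
  interpret F: group "free_group n" by (rule group_free_group)
  show ?thesis
    using foldr_action_mult[of A, OF assms(1) F.inv_closed[OF assms(2)], of xs s] assms(2) by simp
qed


section \<open>Residual nilpotence of free groups\<close>

text \<open>
  A function \<open>f\<close> stands for the noncommutative power series in which \<open>f \<pi>\<close> is the coefficient
  of the monomial \<open>\<pi>\<close>. The generator \<open>x\<^sub>i\<close> acts as multiplication by \<open>1 + X\<^sub>i\<close> on the left.
\<close>

primrec magnus_inv :: "nat \<Rightarrow> (nat list \<Rightarrow> int) \<Rightarrow> nat list \<Rightarrow> int" where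
  "magnus_inv i f [] = f []"
| "magnus_inv i f (j # \<pi>) = f (j # \<pi>) - (if j = i then magnus_inv i f \<pi> else 0)"

definition magnus_gen :: "nat \<Rightarrow> (nat list \<Rightarrow> int) \<Rightarrow> nat list \<Rightarrow> int" where
  "magnus_gen i f \<pi> = f \<pi> + (case \<pi> of [] \<Rightarrow> 0 | j # \<pi>' \<Rightarrow> if j = i then f \<pi>' else 0)"

definition magnus :: "letter \<Rightarrow> (nat list \<Rightarrow> int) \<Rightarrow> nat list \<Rightarrow> int" where
  "magnus x = (if snd x then magnus_gen (fst x) else magnus_inv (fst x))"

section \<open>The filtration of power series by order\<close>

definition vanishes :: "nat \<Rightarrow> (nat list \<Rightarrow> int) \<Rightarrow> bool" where
  "vanishes j f \<longleftrightarrow> (\<forall>\<pi>. length \<pi> < j \<longrightarrow> f \<pi> = 0)"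

text \<open>The recursion in \<open>magnus_inv\<close> solves \<open>magnus_gen i g = f\<close> for
  \<open>g\<close> one coefficient at a time; it is left multiplication by
  \<open>1 - X_i + X_i^2 - ...\<close>.\<close>

lemma magnus_gen_inv: "magnus_gen i (magnus_inv i f) \<pi> = f \<pi>"
  by (cases \<pi>) (auto simp: magnus_gen_def)

lemma magnus_inv_gen: "magnus_inv i (magnus_gen i f) \<pi> = f \<pi>"
  by (induction \<pi>) (auto simp: magnus_gen_def)

lemma magnus_cancel: "magnus x (magnus (letter_inv x) f) = f"
  by (auto simp: magnus_def letter_inv_def magnus_gen_inv magnus_inv_gen fun_eq_iff)

lemma magnus_inv_add: "magnus_inv i (f + g) \<pi> = magnus_inv i f \<pi> + magnus_inv i g \<pi>"
  by (induction \<pi>) auto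

lemma magnus_add: "magnus x (f + g) = magnus x f + magnus x g"
  by (auto simp: magnus_def magnus_inv_add magnus_gen_def fun_eq_iff split: list.split)

lemma foldr_magnus_add: "foldr magnus xs (f + g) = foldr magnus xs f + foldr magnus xs g"
  by (induction xs) (simp_all add: magnus_add del: plus_fun_apply)

lemma vanishes_0 [simp]: "vanishes 0 f"
  by (simp add: vanishes_def)

lemma vanishes_add: "vanishes j f \<Longrightarrow> vanishes j g \<Longrightarrow> vanishes j (f + g)"
  by (simp add: vanishes_def)

lemma vanishes_diff: "vanishes j f \<Longrightarrow> vanishes j g \<Longrightarrow> vanishes j (f - g)"
  by (simp add: vanishes_def)

lemma vanishes_mono: "vanishes j f \<Longrightarrow> i \<le> j \<Longrightarrow> vanishes i f"
  by (simp add: vanishes_def)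

lemma magnus_inv_vanishes: "vanishes j f \<Longrightarrow> length \<pi> < j \<Longrightarrow> magnus_inv i f \<pi> = 0"
  by (induction \<pi>) (auto simp: vanishes_def)

text \<open>A letter multiplies by 1 plus a series without constant term: the coefficient of the
  difference at \<open>i # \<rho>\<close> involves \<open>f\<close> only at suffixes of
  \<open>\<rho>\<close>, which are one degree lower.\<close>

lemma vanishes_magnus: "vanishes j f \<Longrightarrow> vanishes (Suc j) (magnus x f - f)"
  unfolding vanishes_def[of "Suc j"]
proof (intro allI impI)
  fix \<pi> :: "nat list"
  assume f: "vanishes j f" and \<pi>: "length \<pi> < Suc j"
  show "(magnus x f - f) \<pi> = 0"
  proof (cases \<pi>)
    case Nil
    then show ?thesis by (simp add: magnus_def magnus_gen_def)
  next
    case (Cons i \<rho>)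
    with \<pi> have "length \<rho> < j" by simp
    with f Cons show ?thesis
      using magnus_inv_vanishes[OF f \<open>length \<rho> < j\<close>]
      by (auto simp: magnus_def magnus_gen_def vanishes_def)
  qed
qed

text \<open>The dimension subgroups of the free group: the elements congruent to 1 in degrees below \<open>k\<close>.\<close>

definition dimension_subgroup :: "nat \<Rightarrow> nat \<Rightarrow> letter list set" where
  "dimension_subgroup n k = {xs \<in> carrier (free_group n).
     \<forall>j f. vanishes j f \<longrightarrow> vanishes (j + k) (foldr magnus xs f - f)}"

text \<open>Telescoping over the letters of the word. This puts the whole group into
  \<open>dimension_subgroup n 1\<close>, the base case for the lower central series.\<close>

lemma vanishes_foldr_magnus:
  "vanishes j f \<Longrightarrow> vanishes (Suc j) (foldr magnus xs f - f)"
proof (induction xs)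
  case Nil
  then show ?case by (simp add: vanishes_def)
next
  case (Cons x xs)
  let ?g = "foldr magnus xs f"
  have g: "vanishes (Suc j) (?g - f)" using Cons.IH Cons.prems by blast
  have "vanishes j (?g - f + f)"
    using g Cons.prems by (intro vanishes_add) (auto intro: vanishes_mono)
  then have "vanishes (Suc j) (magnus x ?g - ?g)"
    by (intro vanishes_magnus) simp
  then have "vanishes (Suc j) ((magnus x ?g - ?g) + (?g - f))"
    using g by (rule vanishes_add)
  also have "(magnus x ?g - ?g) + (?g - f) = foldr magnus (x # xs) f - f"
    by (simp add: fun_eq_iff)
  finally show ?case .
qed

lemma vanishes_foldr_magnus': "vanishes j f \<Longrightarrow> vanishes j (foldr magnus xs f)"
proof -
  assume f: "vanishes j f"
  have "vanishes j (foldr magnus xs f - f)"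
    using vanishes_foldr_magnus[OF f] by (rule vanishes_mono) simp
  from vanishes_add[OF this f] show ?thesis by simp
qed

text \<open>The condition ranges over all series, so it may be applied to translates of
  \<open>f\<close>: to \<open>x^-1 f\<close> for an inverse, and to \<open>y f\<close> in
  \<open>xy f - f = (x (y f) - y f) + (y f - f)\<close> for a product.\<close>

lemma subgroup_dimension_subgroup: "subgroup (dimension_subgroup n k) (free_group n)"
proof -
  interpret F: group "free_group n" by (rule group_free_group)
  show ?thesis
  proof (rule F.subgroupI)
    show "dimension_subgroup n k \<subseteq> carrier (free_group n)"
      by (auto simp: dimension_subgroup_def)
    have "[] \<in> dimension_subgroup n k"
      by (simp add: dimension_subgroup_def carrier_free_group vanishes_def)
    then show "dimension_subgroup n k \<noteq> {}" by blast
  next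
    fix xs assume xs: "xs \<in> dimension_subgroup n k"
    then have c: "xs \<in> carrier (free_group n)" by (simp add: dimension_subgroup_def)
    show "inv\<^bsub>free_group n\<^esub> xs \<in> dimension_subgroup n k"
      unfolding dimension_subgroup_def
    proof (intro CollectI conjI allI impI)
      show "inv\<^bsub>free_group n\<^esub> xs \<in> carrier (free_group n)" using c by simp
      fix j f assume f: "vanishes j f"
      let ?g = "foldr magnus (inv\<^bsub>free_group n\<^esub> xs) f"
      have "vanishes j ?g" using f by (rule vanishes_foldr_magnus')
      then have "vanishes (j + k) (foldr magnus xs ?g - ?g)"
        using xs by (simp add: dimension_subgroup_def)
      then have "vanishes (j + k) (f - ?g)"
        using foldr_action_inv[of magnus, OF magnus_cancel c] by simp
      then show "vanishes (j + k) (?g - f)"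
        by (simp add: vanishes_def)
    qed
  next
    fix xs ys assume xs: "xs \<in> dimension_subgroup n k" and ys: "ys \<in> dimension_subgroup n k"
    then have c: "xs \<in> carrier (free_group n)" "ys \<in> carrier (free_group n)"
      by (simp_all add: dimension_subgroup_def)
    show "xs \<otimes>\<^bsub>free_group n\<^esub> ys \<in> dimension_subgroup n k"
      unfolding dimension_subgroup_def
    proof (intro CollectI conjI allI impI)
      show "xs \<otimes>\<^bsub>free_group n\<^esub> ys \<in> carrier (free_group n)" using c by simp
      fix j f assume f: "vanishes j f"
      let ?g = "foldr magnus ys f"
      have "vanishes (j + k) (?g - f)"
        using f ys by (simp add: dimension_subgroup_def)
      moreover have "vanishes (j + k) (foldr magnus xs ?g - ?g)"
        using vanishes_foldr_magnus'[OF f] xs by (simp add: dimension_subgroup_def)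
      ultimately have "vanishes (j + k) ((foldr magnus xs ?g - ?g) + (?g - f))"
        by (intro vanishes_add)
      then show "vanishes (j + k) (foldr magnus (xs \<otimes>\<^bsub>free_group n\<^esub> ys) f - f)"
        using foldr_action_mult[of magnus, OF magnus_cancel c(2)] by simp
    qed
  qed
qed

text \<open>With \<open>h = x^-1 y^-1 f\<close> one has \<open>f = y x h\<close>, so the commutator
  changes \<open>f\<close> by \<open>x y h - y x h = (x - 1)(y - 1) h - (y - 1)(x - 1) h\<close>. In
  both terms one factor raises the order by \<open>k\<close> and the other by 1.\<close>

lemma commutator_dimension_subgroup:
  fixes n :: nat
  defines "F \<equiv> free_group n"
  assumes xs: "xs \<in> dimension_subgroup n k" and ys: "ys \<in> carrier F"
  shows "xs \<otimes>\<^bsub>F\<^esub> ys \<otimes>\<^bsub>F\<^esub> inv\<^bsub>F\<^esub> xs \<otimes>\<^bsub>F\<^esub> inv\<^bsub>F\<^esub> ys \<in> dimension_subgroup n (Suc k)"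
  unfolding dimension_subgroup_def
proof (intro CollectI conjI allI impI)
  interpret F: group F unfolding F_def by (rule group_free_group)
  have xsc: "xs \<in> carrier F" using xs by (simp add: dimension_subgroup_def F_def)
  show "xs \<otimes>\<^bsub>F\<^esub> ys \<otimes>\<^bsub>F\<^esub> inv\<^bsub>F\<^esub> xs \<otimes>\<^bsub>F\<^esub> inv\<^bsub>F\<^esub> ys \<in> carrier (free_group n)"
    using xsc ys by (simp flip: F_def)
  fix j f assume f: "vanishes j f"
  define h where "h = foldr magnus (inv\<^bsub>F\<^esub> xs) (foldr magnus (inv\<^bsub>F\<^esub> ys) f)"
  have h: "vanishes j h"
    unfolding h_def by (intro vanishes_foldr_magnus' f)
  have f_eq: "f = foldr magnus ys (foldr magnus xs h)"
    unfolding h_def F_def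
    using foldr_action_inv[of magnus, OF magnus_cancel] xsc ys by (simp add: F_def)
  define s where "s = foldr magnus xs h - h"
  define t where "t = foldr magnus ys h - h"
  have s: "vanishes (j + k) s" using xs h by (simp add: s_def dimension_subgroup_def)
  have t: "vanishes (Suc j) t" using vanishes_foldr_magnus[OF h] by (simp add: t_def)
  have xh: "foldr magnus xs h = h + s" and yh: "foldr magnus ys h = h + t"
    by (simp_all add: s_def t_def)
  have "foldr magnus (xs \<otimes>\<^bsub>F\<^esub> ys \<otimes>\<^bsub>F\<^esub> inv\<^bsub>F\<^esub> xs \<otimes>\<^bsub>F\<^esub> inv\<^bsub>F\<^esub> ys) f = foldr magnus xs (foldr magnus ys h)"
    using foldr_action_mult[of magnus, OF magnus_cancel, where n = n] xsc ys
    by (simp add: h_def flip: F_def)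
  also have "\<dots> = (h + s) + foldr magnus xs t"
    by (simp add: yh foldr_magnus_add xh)
  finally have "foldr magnus (xs \<otimes>\<^bsub>F\<^esub> ys \<otimes>\<^bsub>F\<^esub> inv\<^bsub>F\<^esub> xs \<otimes>\<^bsub>F\<^esub> inv\<^bsub>F\<^esub> ys) f - f =
      (foldr magnus xs t - t) - (foldr magnus ys s - s)"
    by (simp add: f_eq xh foldr_magnus_add yh)
  moreover have "vanishes (Suc j + k) (foldr magnus xs t - t)"
    using xs t unfolding dimension_subgroup_def by blast
  moreover have "vanishes (Suc (j + k)) (foldr magnus ys s - s)"
    using vanishes_foldr_magnus[OF s] .
  ultimately show "vanishes (j + Suc k)
      (foldr magnus (xs \<otimes>\<^bsub>F\<^esub> ys \<otimes>\<^bsub>F\<^esub> inv\<^bsub>F\<^esub> xs \<otimes>\<^bsub>F\<^esub> inv\<^bsub>F\<^esub> ys) f - f)"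
    by (simp add: vanishes_diff)
qed

lemma lower_central_subset_dimension_subgroup:
  "lower_central (free_group n) (Suc k) \<subseteq> dimension_subgroup n (Suc k)"
proof (induction k)
  case 0
  then show ?case
    using vanishes_foldr_magnus by (auto simp: dimension_subgroup_def)
next
  case (Suc k)
  interpret F: group "free_group n" by (rule group_free_group)
  show ?case
    unfolding lower_central.simps commutator_subgroup_def
    using Suc commutator_dimension_subgroup
    by (intro F.generate_subgroup_incl subgroup_dimension_subgroup) blast
qed

section \<open>Coefficients of the Magnus expansion, the image of the constant series 1\<close>

definition magnus_coeff :: "letter list \<Rightarrow> nat list \<Rightarrow> int" where
  "magnus_coeff xs = foldr magnus xs (\<lambda>\<pi>. if \<pi> = [] then 1 else 0)"

definition letter_sign :: "letter \<Rightarrow> int" where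
  "letter_sign x = (if snd x then 1 else - 1)"

lemma magnus_coeff_Nil: "magnus_coeff [] \<pi> = (if \<pi> = [] then 1 else 0)"
  by (simp add: magnus_coeff_def)

lemma magnus_coeff_Cons_hd_neq:
  "\<rho> = [] \<or> hd \<rho> \<noteq> fst x \<Longrightarrow> magnus_coeff (x # xs) \<rho> = magnus_coeff xs \<rho>"
  by (cases \<rho>) (auto simp: magnus_coeff_def magnus_def magnus_gen_def)

text \<open>In a monomial without equal neighbours only the constant and the linear term of
  \<open>(1 + X_i)^(+-1)\<close> can contribute, as all others would produce a factor
  \<open>X_i^2\<close>.\<close>

lemma magnus_coeff_Cons:
  assumes "distinct_adj (fst x # \<rho>)"
  shows "magnus_coeff (x # xs) (fst x # \<rho>) =
    magnus_coeff xs (fst x # \<rho>) + letter_sign x * magnus_coeff xs \<rho>"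
  using assms by (cases \<rho>) (auto simp: magnus_coeff_def magnus_def magnus_gen_def letter_sign_def)

lemma remdups_adj_Cons_hd:
  "remdups_adj (x # xs) =
    (if xs \<noteq> [] \<and> hd xs = x then remdups_adj xs else x # remdups_adj xs)"
  by (cases xs) auto

text \<open>A run of letters with the same index contributes at most one factor to a monomial
  without equal neighbours, so the monomial can be read off along the sequence of syllable
  indices.\<close>

lemma magnus_coeff_subseq:
  assumes "magnus_coeff xs \<rho> \<noteq> 0" "distinct_adj \<rho>"
  shows "subseq \<rho> (remdups_adj (map fst xs))"
  using assms
proof (induction xs arbitrary: \<rho>)
  case Nil
  then show ?case by (simp add: magnus_coeff_Nil split: if_splits)
next
  case (Cons x xs)
  define r where "r = remdups_adj (map fst xs)"
  have r': "remdups_adj (map fst (x # xs)) = (if r \<noteq> [] \<and> hd r = fst x then r else fst x # r)"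
    by (simp add: remdups_adj_Cons_hd r_def del: remdups_adj.simps)
  have IH: "magnus_coeff xs \<rho> \<noteq> 0 \<Longrightarrow> distinct_adj \<rho> \<Longrightarrow> subseq \<rho> r" for \<rho>
    unfolding r_def by (rule Cons.IH)
  show ?case
  proof (cases "magnus_coeff xs \<rho> = 0")
    case False
    then have "subseq \<rho> r" using IH Cons.prems(2) by blast
    then show ?thesis unfolding r' by auto
  next
    case True
    then have "\<rho> \<noteq> [] \<and> hd \<rho> = fst x"
      using Cons.prems(1) magnus_coeff_Cons_hd_neq by metis
    then obtain \<rho>' where \<rho>: "\<rho> = fst x # \<rho>'" by (cases \<rho>) auto
    then have "magnus_coeff xs \<rho>' \<noteq> 0"
      using Cons.prems True magnus_coeff_Cons[of x \<rho>' xs] by auto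
    moreover have adj: "distinct_adj \<rho>'" "\<rho>' = [] \<or> hd \<rho>' \<noteq> fst x"
      using Cons.prems(2) \<rho> by (auto simp: distinct_adj_Cons)
    ultimately have s: "subseq \<rho>' r" using IH by blast
    show ?thesis
    proof (cases "r \<noteq> [] \<and> hd r = fst x")
      case True
      then obtain r0 where r0: "r = fst x # r0" by (cases r) auto
      have "subseq \<rho>' r0"
        using s adj(2) unfolding r0 by (cases \<rho>') (auto simp: subseq_Cons2_neq)
      then show ?thesis unfolding r' \<rho> r0 by simp
    next
      case False
      with s show ?thesis unfolding r' \<rho> if_not_P[OF False] by simp
    qed
  qed
qed

text \<open>In a reduced word each syllable is a power of one letter, and the coefficient at the
  monomial of all syllables is the product of the syllable exponents. The induction carries the
  coefficients at \<open>\<pi>\<close> and \<open>tl \<pi>\<close> together: a letter prolonging the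
  first syllable raises the factor \<open>m\<close> by 1, and a new syllable restarts it at
  1.\<close>

lemma magnus_coeff_syllables:
  assumes "reduced (x # xs)"
  defines "\<pi> \<equiv> remdups_adj (map fst (x # xs))"
  shows "\<exists>m\<ge>1. magnus_coeff (x # xs) \<pi> = letter_sign x * m * magnus_coeff (x # xs) (tl \<pi>) \<and>
    magnus_coeff (x # xs) (tl \<pi>) \<noteq> 0"
  using assms(1) unfolding \<pi>_def
proof (induction xs arbitrary: x)
  case Nil
  then show ?case
    using magnus_coeff_Cons[of x "[]" "[]"]
    by (intro exI[of _ 1]) (simp add: magnus_coeff_Nil magnus_coeff_Cons_hd_neq)
next
  case (Cons y ys)
  define r where "r = remdups_adj (map fst (y # ys))"
  from Cons.prems have red: "reduced (y # ys)" and yx: "y \<noteq> letter_inv x"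
    by (auto simp: reduced_Cons)
  obtain m where m: "m \<ge> 1"
    "magnus_coeff (y # ys) r = letter_sign y * m * magnus_coeff (y # ys) (tl r)"
    "magnus_coeff (y # ys) (tl r) \<noteq> 0"
    using Cons.IH[OF red] unfolding r_def by blast
  have da: "distinct_adj r" unfolding r_def by (rule distinct_adj_remdups_adj)
  have "r \<noteq> []" "hd r = fst y"
    unfolding r_def by (simp_all only: remdups_adj_Nil_iff hd_remdups_adj list.map list.sel) simp
  then obtain r0 where r0: "r = fst y # r0"
    by (cases r) auto
  have r': "remdups_adj (map fst (x # y # ys)) = (if fst y = fst x then r else fst x # r)"
    unfolding r_def by (subst list.map, subst remdups_adj_Cons_hd) simp
  show ?case
  proof (cases "fst y = fst x")
    case True
    then have xy: "y = x" using yx by (cases x; cases y) (auto simp: letter_inv_def)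
    have "r0 = [] \<or> hd r0 \<noteq> fst x" using da r0 xy by (auto simp: distinct_adj_Cons)
    then have tl: "magnus_coeff (x # y # ys) r0 = magnus_coeff (y # ys) r0"
      by (simp add: magnus_coeff_Cons_hd_neq)
    have "magnus_coeff (x # y # ys) r = magnus_coeff (y # ys) r + letter_sign x * magnus_coeff (y # ys) r0"
      using da magnus_coeff_Cons[of x r0 "y # ys"] unfolding r0 xy by simp
    also have "\<dots> = letter_sign x * (m + 1) * magnus_coeff (x # y # ys) r0"
      using m(2) r0 tl xy by (simp add: algebra_simps)
    finally show ?thesis
      using m(1,3) r0 tl True unfolding r' by (intro exI[of _ "m + 1"]) simp
  next
    case False
    have adj: "distinct_adj (fst x # r)" using da False r0 by (simp add: distinct_adj_Cons)
    \<comment> \<open>The letter \<open>x\<close> opens a new syllable, and the longer monomial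
      cannot occur before \<open>x\<close> is multiplied on.\<close>
    have "\<not> subseq (fst x # r) r" by (auto dest: list_emb_length)
    then have "magnus_coeff (y # ys) (fst x # r) = 0"
      using magnus_coeff_subseq[OF _ adj] unfolding r_def by blast
    then have 1: "magnus_coeff (x # y # ys) (fst x # r) = letter_sign x * magnus_coeff (y # ys) r"
      using magnus_coeff_Cons[OF adj] by simp
    have 2: "magnus_coeff (x # y # ys) r = magnus_coeff (y # ys) r"
      using False r0 by (simp add: magnus_coeff_Cons_hd_neq)
    have "magnus_coeff (y # ys) r \<noteq> 0"
      using m by (simp add: letter_sign_def split: if_splits)
    then show ?thesis
      using False 1 2 unfolding r' by (intro exI[of _ 1]) simp
  qed
qed

text \<open>Membership in the term of index \<open>length \<pi> + 1\<close> forces the Magnus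
  coefficient at the syllable monomial \<open>\<pi>\<close> of a nonempty word to be 0, although
  that coefficient is a product of nonzero exponents.\<close>

theorem free_group_residually_nilpotent:
  assumes "\<And>k. k \<ge> 1 \<Longrightarrow> xs \<in> lower_central (free_group n) k"
  shows "xs = []"
proof (cases xs)
  case (Cons x ys)
  define \<pi> where "\<pi> = remdups_adj (map fst xs)"
  have dim: "xs \<in> dimension_subgroup n (Suc k)" for k
    using assms[of "Suc k"] lower_central_subset_dimension_subgroup[of n k] by auto
  then have "reduced xs" by (auto simp: dimension_subgroup_def carrier_free_group)
  then obtain m where m: "m \<ge> 1" "magnus_coeff xs \<pi> = letter_sign x * m * magnus_coeff xs (tl \<pi>)"
    "magnus_coeff xs (tl \<pi>) \<noteq> 0"
    using magnus_coeff_syllables[of x ys] unfolding Cons \<pi>_def by blast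
  then have "magnus_coeff xs \<pi> \<noteq> 0"
    by (auto simp: letter_sign_def)
  moreover have "\<pi> \<noteq> []" unfolding Cons \<pi>_def by simp
  moreover have "vanishes (0 + Suc (length \<pi>)) (magnus_coeff xs - (\<lambda>\<pi>. if \<pi> = [] then 1 else 0))"
    using dim vanishes_0 unfolding dimension_subgroup_def magnus_coeff_def by blast
  ultimately show ?thesis by (auto simp: vanishes_def)
qed simp


section \<open>Exponent sums\<close>

definition expo :: "nat \<Rightarrow> letter list \<Rightarrow> int" where
  "expo i xs = (\<Sum>x\<leftarrow>xs. if fst x = i then letter_sign x else 0)"

lemma expo_Nil [simp]: "expo i [] = 0"
  by (simp add: expo_def)

lemma expo_Cons: "expo i (x # xs) = (if fst x = i then letter_sign x else 0) + expo i xs"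
  by (simp add: expo_def)

lemma expo_push: "expo i (push x ys) = expo i (x # ys)"
  by (cases ys) (auto simp: push_def expo_Cons letter_inv_def letter_sign_def)

lemma expo_mult:
  "ys \<in> carrier (free_group n) \<Longrightarrow> expo i (xs \<otimes>\<^bsub>free_group n\<^esub> ys) = expo i xs + expo i ys"
  by (induction xs) (simp_all add: mult_free_group expo_push expo_Cons)

lemma expo_inv:
  assumes "xs \<in> carrier (free_group n)"
  shows "expo i (inv\<^bsub>free_group n\<^esub> xs) = - expo i xs"
proof -
  interpret F: group "free_group n" by (rule group_free_group)
  show ?thesis
    using expo_mult[OF assms, of i "inv\<^bsub>free_group n\<^esub> xs"] assms by simp
qed

lemma expo_nat_pow:
  assumes "xs \<in> carrier (free_group n)"
  shows "expo i (xs [^]\<^bsub>free_group n\<^esub> (m::nat)) = int m * expo i xs"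
proof -
  interpret F: group "free_group n" by (rule group_free_group)
  show ?thesis
    by (induction m) (simp_all add: expo_mult[OF assms] distrib_right)
qed

lemma expo_int_pow:
  assumes "xs \<in> carrier (free_group n)"
  shows "expo i (xs [^]\<^bsub>free_group n\<^esub> (k::int)) = k * expo i xs"
proof -
  interpret F: group "free_group n" by (rule group_free_group)
  show ?thesis
    using assms by (cases k rule: int_cases2) (simp_all add: int_pow_int F.int_pow_neg_int expo_inv expo_nat_pow)
qed

lemma expo_not_occurring: "i \<notin> fst ` set xs \<Longrightarrow> expo i xs = 0"
  by (induction xs) (auto simp: expo_Cons)

lemma expo_word_val2:
  assumes "fst ` set w \<subseteq> {..<2}" "x \<in> carrier (free_group n)" "y \<in> carrier (free_group n)"
  shows "expo i (word_val2 (free_group n) w x y) = expo 0 w * expo i x + expo 1 w * expo i y"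
proof -
  interpret F: group "free_group n" by (rule group_free_group)
  let ?f = "\<lambda>i. if i = 0 then x else y"
  have "expo i (word_val (free_group n) ?f w) = expo 0 w * expo i x + expo 1 w * expo i y"
    using assms(1)
  proof (induction w)
    case (Cons z w)
    have "word_val (free_group n) ?f w \<in> carrier (free_group n)"
      using assms by (intro F.word_val_closed) auto
    then show ?case
      using Cons assms less_2_cases[of "fst z"]
      by (auto simp: expo_mult expo_Cons letter_val_def expo_inv letter_sign_def algebra_simps)
  qed simp
  then show ?thesis by (simp add: word_val2_def)
qed

text \<open>Exponent sums are homomorphisms to an abelian group and so kill commutators. Thus they
  are well defined on cosets of the second term.\<close>

lemma expo_lower_central_2:
  assumes "xs \<in> lower_central (free_group n) 2"
  shows "expo i xs = 0"
proof -
  let ?F = "free_group n"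
  interpret F: group ?F by (rule group_free_group)
  let ?K = "{xs \<in> carrier ?F. expo i xs = 0}"
  have "[] \<in> ?K"
    by (simp add: carrier_free_group)
  then have "subgroup ?K ?F"
    by (intro F.subgroupI) (auto simp: expo_mult expo_inv)
  then have "lower_central ?F 2 \<subseteq> ?K"
    unfolding numeral_2_eq_2 lower_central.simps commutator_subgroup_def
    by (intro F.generate_subgroup_incl) (auto simp: expo_mult expo_inv)
  with assms show ?thesis by blast
qed

lemma reduced_single_generator:
  assumes "reduced xs" "fst ` set xs \<subseteq> {i}"
  shows "\<exists>m s. xs = replicate m (i, s)"
  using assms
proof (induction xs)
  case (Cons x xs)
  then obtain m s where xs: "xs = replicate m (i, s)"
    by (auto simp: reduced_Cons)
  obtain t where x: "x = (i, t)" using Cons.prems by (cases x) auto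
  show ?case
  proof (cases m)
    case 0
    then show ?thesis using xs x by (intro exI[of _ 1]) auto
  next
    case (Suc m')
    then have "s = t" using Cons.prems xs x by (auto simp: reduced_Cons letter_inv_def)
    then show ?thesis using xs x by (intro exI[of _ "Suc m"] exI[of _ s]) simp
  qed
qed simp

lemma expo_replicate: "expo i (replicate m (i, s)) = letter_sign (i, s) * int m"
  by (induction m) (simp_all add: expo_Cons algebra_simps)


section \<open>Normal forms of substituted words\<close>

lemma reduced_append:
  "reduced (xs @ ys) \<longleftrightarrow>
    reduced xs \<and> reduced ys \<and> (xs = [] \<or> ys = [] \<or> hd ys \<noteq> letter_inv (last xs))"
  by (auto simp: reduced_def successively_append_iff)

lemma mult_free_group_append:
  "reduced (xs @ ys) \<Longrightarrow> xs \<otimes>\<^bsub>free_group n\<^esub> ys = xs @ ys"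
  by (simp add: free_group_def reduce_reduced)

lemma inv_free_group:
  assumes "xs \<in> carrier (free_group n)"
  shows "inv\<^bsub>free_group n\<^esub> xs = rev (map letter_inv xs)"
proof -
  interpret F: group "free_group n" by (rule group_free_group)
  show ?thesis
  proof (rule F.inv_equality)
    show "rev (map letter_inv xs) \<otimes>\<^bsub>free_group n\<^esub> xs = \<one>\<^bsub>free_group n\<^esub>"
      using foldr_push_inverse[of "[]" xs] reduce_reduced[of xs] assms
      by (simp add: mult_free_group) (simp add: carrier_free_group reduce_def)
    show "rev (map letter_inv xs) \<in> carrier (free_group n)"
      using assms by (auto simp: carrier_free_group reduced_rev_inverse letter_inv_def)
  qed (fact assms)
qed

lemma subgroup_words_over:
  "subgroup {xs \<in> carrier (free_group n). fst ` set xs \<subseteq> S} (free_group n)"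
proof -
  interpret F: group "free_group n" by (rule group_free_group)
  let ?H = "{xs \<in> carrier (free_group n). fst ` set xs \<subseteq> S}"
  show ?thesis
  proof (rule F.subgroupI)
    have "[] \<in> ?H"
      by (simp add: carrier_free_group)
    then show "?H \<noteq> {}" by blast
  next
    fix xs assume "xs \<in> ?H"
    then show "inv\<^bsub>free_group n\<^esub> xs \<in> ?H"
      using F.inv_closed[of xs] by (auto simp: inv_free_group letter_inv_def)
  next
    fix xs ys assume "xs \<in> ?H" "ys \<in> ?H"
    then show "xs \<otimes>\<^bsub>free_group n\<^esub> ys \<in> ?H"
      using F.m_closed[of xs ys] set_foldr_push[of xs ys] by (force simp: mult_free_group)
  qed blast
qed

lemma (in group) word_val_in_subgroup:
  assumes "subgroup H G" "f ` fst ` set w \<subseteq> H"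
  shows "word_val G f w \<in> H"
  using assms(2)
proof (induction w)
  case Nil
  then show ?case using subgroup.one_closed[OF assms(1)] by simp
next
  case (Cons x w)
  then show ?case
    using subgroup.m_closed[OF assms(1)] subgroup.m_inv_closed[OF assms(1)]
    by (simp add: letter_val_def)
qed

lemma word_val_cong: "(\<And>x. x \<in> set w \<Longrightarrow> f (fst x) = g (fst x)) \<Longrightarrow> word_val G f w = word_val G g w"
  by (induction w) (simp_all add: word_val_def letter_val_def)

lemma (in group) word_val_append:
  "f ` fst ` set (xs @ ys) \<subseteq> carrier G \<Longrightarrow>
    word_val G f (xs @ ys) = word_val G f xs \<otimes> word_val G f ys"
proof (induction xs)
  case (Cons x xs)
  then show ?case
    using letter_val_closed[of f x] word_val_closed[of f xs] word_val_closed[of f ys]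
    by (simp add: m_assoc image_Un)
qed (simp add: word_val_closed)

lemma word_val_gen:
  assumes "w \<in> carrier (free_group n)"
  shows "word_val (free_group n) gen w = w"
proof -
  interpret F: group "free_group n" by (rule group_free_group)
  have "id \<in> hom (free_group n) (free_group n)" by (simp add: hom_def)
  from F.word_val_unique[OF this _ assms, of gen] show ?thesis by simp
qed

lemma expo_single_generator_nonzero:
  assumes "reduced xs" "fst ` set xs \<subseteq> {i}" "xs \<noteq> []"
  shows "expo i xs \<noteq> 0"
  using reduced_single_generator[OF assms(1,2)] assms(3)
  by (auto simp: expo_replicate letter_sign_def split: if_splits)

text \<open>Letters \<open>z\<close> enter only through \<open>i\<close>. Two opposite ones could
  cancel only across a trivial power of \<open>u\<close>, but nonzero powers of \<open>u\<close> are
  nontrivial because their exponent sum at \<open>l\<close> is nonzero. So all letters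
  \<open>z\<close> survive, and the first of them marks the end of a power of
  \<open>u\<close>.\<close>

lemma word_val_normal_form:
  fixes n i :: nat and v :: "letter list"
  defines "F \<equiv> free_group n"
  defines "P \<equiv> takeWhile (\<lambda>x. fst x \<noteq> i)" and "D \<equiv> dropWhile (\<lambda>x. fst x \<noteq> i)"
  assumes f: "f i = gen z" "f j = u" and z: "z < n"
    and u: "u \<in> carrier F" "z \<notin> fst ` set u" "expo l u \<noteq> 0"
    and v: "reduced v" "fst ` set v \<subseteq> {i, j}"
  shows "word_val F f v = u [^]\<^bsub>F\<^esub> expo j (P v) @ word_val F f (D v)"
    and "D v \<noteq> [] \<Longrightarrow> word_val F f (D v) \<noteq> [] \<and> hd (word_val F f (D v)) = (z, snd (hd (D v)))"
proof -
  interpret F: group F unfolding F_def by (rule group_free_group)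
  define val where "val = word_val F f"
  have subF: "subgroup {xs \<in> carrier F. fst ` set xs \<subseteq> - {z}} F"
    unfolding F_def by (rule subgroup_words_over)
  have upow: "u [^]\<^bsub>F\<^esub> k \<in> carrier F" "z \<notin> fst ` set (u [^]\<^bsub>F\<^esub> k)" for k :: int
    using F.subgroup_int_pow_closed[OF subF, of u k] u by auto
  have upow_nonempty: "u [^]\<^bsub>F\<^esub> k \<noteq> []" if "k \<noteq> 0" for k :: int
    using expo_int_pow[of u n l k] u that by (auto simp: F_def)
  have fc: "f i \<in> carrier F" "f j \<in> carrier F"
    using f u z by (simp_all add: F_def gen_in_carrier)
  have valc: "val w \<in> carrier F" if "fst ` set w \<subseteq> {i, j}" for w
    unfolding val_def using that fc by (intro F.word_val_closed) auto
  have red: "reduced w" if "w \<in> carrier F" for w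
    using that by (simp add: F_def carrier_free_group)
  have "val v = u [^]\<^bsub>F\<^esub> expo j (P v) @ val (D v) \<and>
    (D v \<noteq> [] \<longrightarrow> val (D v) \<noteq> [] \<and> hd (val (D v)) = (z, snd (hd (D v))))"
    using v
  proof (induction v)
    case Nil
    then show ?case by (simp add: P_def D_def val_def F_def)
  next
    case (Cons x v)
    have v: "reduced v" "fst ` set v \<subseteq> {i, j}"
      using Cons.prems by (auto simp: reduced_Cons)
    have IH: "val v = u [^]\<^bsub>F\<^esub> expo j (P v) @ val (D v)"
      "D v \<noteq> [] \<Longrightarrow> val (D v) \<noteq> [] \<and> hd (val (D v)) = (z, snd (hd (D v)))"
      using Cons.IH v by auto
    have Dc: "val (D v) \<in> carrier F"
      using v set_dropWhileD[of _ "\<lambda>x. fst x \<noteq> i" v] by (intro valc) (auto simp: D_def)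
    have cons: "val (x # v) = letter_val F f x \<otimes>\<^bsub>F\<^esub> val v"
      by (simp add: val_def)
    show ?case
    proof (cases "fst x = i")
      case True
      \<comment> \<open>The new letter meets either a \<open>z\<close>-letter of the same sign,
        since the substituted word is reduced, or a nonempty power of \<open>u\<close>, which
        contains no \<open>z\<close>.\<close>
      have no_cancel: "val v = [] \<or> hd (val v) \<noteq> (z, \<not> snd x)"
      proof (cases v)
        case Nil
        then show ?thesis by (simp add: val_def word_val_def F_def)
      next
        case (Cons y v')
        show ?thesis
        proof (cases "fst y = i")
          case True
          with Cons have "D v = v" by (simp add: D_def)
          moreover have "snd y = snd x"
            using Cons.prems Cons True \<open>fst x = i\<close>
            by (cases x; cases y) (auto simp: reduced_Cons letter_inv_def)
          ultimately show ?thesis using IH(2) Cons by auto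
        next
          case False
          with Cons have "P v \<noteq> []" by (simp add: P_def)
          moreover have "reduced (P v)"
            using v(1) takeWhile_dropWhile_id[of "\<lambda>x. fst x \<noteq> i" v] reduced_append[of "P v" "D v"]
            by (simp add: P_def D_def)
          moreover have "fst ` set (P v) \<subseteq> {j}"
            using v(2) set_takeWhileD[of _ "\<lambda>x. fst x \<noteq> i" v] by (auto simp: P_def)
          ultimately have "u [^]\<^bsub>F\<^esub> expo j (P v) \<noteq> []"
            by (intro upow_nonempty expo_single_generator_nonzero)
          then have "hd (val v) \<in> set (u [^]\<^bsub>F\<^esub> expo j (P v))"
            by (simp add: IH(1))
          then show ?thesis using upow(2)[of "expo j (P v)"] by force
        qed
      qed
      have "letter_val F f x = [(z, snd x)]"
        using True f inv_free_group[OF gen_in_carrier[OF z]]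
        by (auto simp: letter_val_def F_def gen_def letter_inv_def)
      then have "val (x # v) = push (z, snd x) (val v)"
        using valc[OF v(2)] by (simp add: cons F_def mult_free_group)
      also have "\<dots> = (z, snd x) # val v"
        using no_cancel by (auto simp: push_def letter_inv_def)
      finally show ?thesis using True by (simp add: P_def D_def F_def)
    next
      case False
      with Cons.prems have x: "fst x = j" by auto
      have PD: "P (x # v) = x # P v" "D (x # v) = D v"
        using False by (simp_all add: P_def D_def)
      \<comment> \<open>No cancellation: the power of \<open>u\<close> avoids \<open>z\<close>,
        whereas the value of \<open>D v\<close>, if \<open>D v\<close> is nonempty, starts with a
        \<open>z\<close>-letter.\<close>
      have app: "u [^]\<^bsub>F\<^esub> k @ val (D v) = u [^]\<^bsub>F\<^esub> k \<otimes>\<^bsub>F\<^esub> val (D v)" for k :: int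
      proof (cases "u [^]\<^bsub>F\<^esub> k = [] \<or> D v = []")
        case True
        then show ?thesis using red[OF Dc] red[OF upow(1)[of k]]
          by (auto simp: F_def val_def word_val_def mult_free_group_append)
      next
        case False
        then have "last (u [^]\<^bsub>F\<^esub> k) \<in> set (u [^]\<^bsub>F\<^esub> k)" by simp
        then have "fst (last (u [^]\<^bsub>F\<^esub> k)) \<noteq> z" using upow(2)[of k] by force
        then have "reduced (u [^]\<^bsub>F\<^esub> k @ val (D v))"
          using red[OF Dc] red[OF upow(1)] False IH(2)
          by (auto simp: reduced_append letter_inv_def)
        then show ?thesis by (simp add: F_def mult_free_group_append)
      qed
      have "letter_val F f x = u [^]\<^bsub>F\<^esub> letter_sign x"
        using x f u by (auto simp: letter_val_def letter_sign_def F.int_pow_neg)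
      then have "val (x # v) = u [^]\<^bsub>F\<^esub> (letter_sign x + expo j (P v)) \<otimes>\<^bsub>F\<^esub> val (D v)"
        using u upow Dc by (simp add: cons IH(1) app F.int_pow_mult F.m_assoc)
      then have "val (x # v) = u [^]\<^bsub>F\<^esub> expo j (P (x # v)) @ val (D (x # v))"
        by (simp add: PD x expo_Cons app)
      then show ?thesis using IH(2) by (simp add: PD)
    qed
  qed
  then show "word_val F f v = u [^]\<^bsub>F\<^esub> expo j (P v) @ word_val F f (D v)"
    and "D v \<noteq> [] \<Longrightarrow> word_val F f (D v) \<noteq> [] \<and> hd (word_val F f (D v)) = (z, snd (hd (D v)))"
    unfolding val_def by auto
qed


section \<open>Powers in the affine group\<close>

text \<open>The affine action of the Baumslag-Solitar group \<open>BS(1,2)\<close>, pulled back to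
  the free group.\<close>

definition affine :: "letter \<Rightarrow> rat \<Rightarrow> rat" where
  "affine x r =
    (if fst x = 0 then r + of_int (letter_sign x)
     else if fst x = 1 then 2 powi letter_sign x * r else r)"

lemma affine_cancel: "affine x (affine (letter_inv x) r) = r"
  by (cases x) (auto simp: affine_def letter_inv_def letter_sign_def)

lemma foldr_affine: "foldr affine xs r = 2 powi expo 1 xs * r + foldr affine xs 0"
proof (induction xs)
  case (Cons x xs)
  show ?case
    by (simp, subst (1) Cons) (auto simp: affine_def expo_Cons power_int_add algebra_simps)
qed simp

text \<open>Each letter adds an integer, doubles, halves or does nothing; raising the exponent of 2
  by one per letter absorbs a possible halving.\<close>

lemma foldr_affine_dyadic: "\<exists>(k::int) j. foldr affine xs 0 * 2 ^ j = of_int k"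
proof (induction xs)
  case Nil
  then show ?case by (intro exI[of _ 0]) simp
next
  case (Cons x xs)
  then obtain k :: int and j where k: "foldr affine xs 0 * 2 ^ j = of_int k" by blast
  have "affine x (foldr affine xs 0) * 2 ^ Suc j =
    of_int (if fst x = 0 then 2 * k + letter_sign x * 2 ^ Suc j
      else if fst x = 1 then (if snd x then 4 * k else k) else 2 * k)"
    by (auto simp: affine_def letter_sign_def k[symmetric] algebra_simps)
  then show ?case by (auto simp only: foldr_Cons comp_apply)
qed

text \<open>With \<open>t = foldr affine u 0\<close> the word acts as
  \<open>r \<mapsto> 2 r + t\<close>, which doubles the displacement \<open>r + t\<close> from the
  fixed point \<open>- t\<close>.\<close>

lemma foldr_affine_nat_pow:
  assumes "u \<in> carrier (free_group n)" "expo 1 u = 1"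
  shows "foldr affine (u [^]\<^bsub>free_group n\<^esub> (m::nat)) r =
    2 ^ m * (r + foldr affine u 0) - foldr affine u 0"
proof -
  interpret F: group "free_group n" by (rule group_free_group)
  show ?thesis
  proof (induction m arbitrary: r)
    case (Suc m)
    have "foldr affine u r = 2 * r + foldr affine u 0"
      using foldr_affine[of u r] assms(2) by simp
    then show ?case
      using foldr_action_mult[of affine, OF affine_cancel assms(1)]
      by (simp add: Suc algebra_simps)
  qed simp
qed

lemma foldr_affine_replicate:
  "foldr affine (replicate m (0, s)) r = r + of_int (letter_sign (0, s) * int m)"
  by (induction m) (auto simp: affine_def algebra_simps)

lemma foldr_affine_no_translation: "0 \<notin> fst ` set xs \<Longrightarrow> foldr affine xs 0 = 0"
  by (induction xs) (auto simp: affine_def)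

text \<open>The divisor is odd, so it already divides \<open>m\<close>; but
  \<open>2^m - 1 > m\<close> once \<open>m \<ge> 2\<close>.\<close>

lemma two_power_minus_one_dvd:
  assumes "(2 ^ m - 1 :: int) dvd int m * 2 ^ j" "m \<ge> 1"
  shows "m = 1"
proof (rule ccontr)
  assume "m \<noteq> 1"
  with assms(2) have m: "m \<ge> 2" by simp
  have "coprime (2 ^ m - 1 :: int) (2 ^ j)"
    using assms(2) by (intro coprime_power_right_iff[THEN iffD2] disjI1) simp
  then have "(2 ^ m - 1 :: int) dvd int m"
    using assms(1) by (simp add: coprime_dvd_mult_left_iff)
  then have "2 ^ m - 1 \<le> int m"
    using assms(2) by (intro zdvd_imp_le) auto
  moreover have "int m + 1 < 2 ^ m"
    using m by (induction m rule: dec_induct) auto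
  ultimately show False by simp
qed

text \<open>The map \<open>x \<mapsto> 2 x + t\<close> has fixed point \<open>- t\<close>, so evaluating the hypothesis at 0 gives
  \<open>t (2\<^sup>p - 1) = p\<close> with \<open>t\<close> dyadic.\<close>

lemma power_eq_first_generator_power:
  fixes n :: nat
  defines "F \<equiv> free_group n"
  assumes u: "u \<in> carrier F" "expo 1 u = 1" and m: "m \<ge> 1" and ys: "0 \<notin> fst ` set ys"
    and eq: "u [^]\<^bsub>F\<^esub> (letter_sign (0, s) * int m) = replicate m (0, s) @ ys"
  shows "m = 1"
proof -
  interpret F: group F unfolding F_def by (rule group_free_group)
  define t where "t = foldr affine u 0"
  have pow: "foldr affine (u [^]\<^bsub>F\<^esub> m) r = 2 ^ m * (r + t) - t" for r
    unfolding t_def F_def using u by (intro foldr_affine_nat_pow) (simp_all add: F_def)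
  have p: "foldr affine (u [^]\<^bsub>F\<^esub> (letter_sign (0, s) * int m)) 0 = of_int (letter_sign (0, s) * int m)"
    unfolding eq foldr_append comp_apply foldr_affine_no_translation[OF ys] foldr_affine_replicate
    by simp
  \<comment> \<open>For the exponent \<open>m\<close>, evaluation at 0 gives
    \<open>(2^m - 1) t = m\<close>, so \<open>e = 0\<close>. For \<open>- m\<close>, the power
    \<open>u^m\<close> sends \<open>- m\<close> to 0, which gives
    \<open>(2^m - 1) t = m 2^m\<close>, so \<open>e = m\<close>.\<close>
  have "\<exists>e::nat. (2 ^ m - 1) * t = of_nat m * 2 ^ e"
  proof (cases s)
    case True
    then have "2 ^ m * t - t = of_nat m"
      using p pow[of 0] by (simp add: letter_sign_def int_pow_int)
    then show ?thesis by (intro exI[of _ 0]) (simp add: algebra_simps)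
  next
    case False
    then have "foldr affine (inv\<^bsub>F\<^esub> (u [^]\<^bsub>F\<^esub> m)) 0 = - of_nat m"
      using p u by (simp add: letter_sign_def F.int_pow_neg_int)
    moreover have "u [^]\<^bsub>F\<^esub> m \<in> carrier F" using u by simp
    ultimately have "2 ^ m * (- of_nat m + t) - t = 0"
      using foldr_action_inv[of affine "u [^]\<^bsub>F\<^esub> m" n 0, OF affine_cancel] pow
      by (simp add: F_def)
    then show ?thesis by (intro exI[of _ m]) (simp add: algebra_simps)
  qed
  then obtain e :: nat where e: "(2 ^ m - 1) * t = of_nat m * 2 ^ e" by blast
  obtain k :: int and j where k: "t * 2 ^ j = of_int k"
    using foldr_affine_dyadic[of u] unfolding t_def by blast
  \<comment> \<open>Multiplication by \<open>2^j\<close> clears the dyadic denominator of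
    \<open>t\<close> and yields a divisibility between integers.\<close>
  have "(of_int ((2 ^ m - 1) * k) :: rat) = (2 ^ m - 1) * t * 2 ^ j"
    by (simp add: k[symmetric])
  also have "\<dots> = of_int (int m * 2 ^ (e + j))"
    by (simp add: e power_add)
  finally have "(2 ^ m - 1) * k = int m * 2 ^ (e + j)"
    by (simp only: of_int_eq_iff)
  then have "(2 ^ m - 1) dvd int m * 2 ^ (e + j)"
    by (metis dvd_triv_left)
  then show ?thesis using m by (rule two_power_minus_one_dvd)
qed


section \<open>Associative words\<close>

lemma takeWhile_eq_replicate:
  assumes "reduced w" "fst ` set w \<subseteq> {i, j}"
  shows "\<exists>m s. takeWhile (\<lambda>x. fst x \<noteq> i) w = replicate m (j, s)"
proof (rule reduced_single_generator)
  show "reduced (takeWhile (\<lambda>x. fst x \<noteq> i) w)"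
    using assms(1) reduced_append[of "takeWhile (\<lambda>x. fst x \<noteq> i) w" "dropWhile (\<lambda>x. fst x \<noteq> i) w"]
    by simp
  show "fst ` set (takeWhile (\<lambda>x. fst x \<noteq> i) w) \<subseteq> {j}"
    using assms(2) set_takeWhileD[of _ "\<lambda>x. fst x \<noteq> i" w] by auto
qed

text \<open>
  Let \<open>w = a\<^sup>p b\<^sup>q \<dots>\<close> with \<open>p, q \<noteq> 0\<close>. In \<open>w(w(a,b),c)\<close> the letters before the first
  \<open>c\<^sup>\<plusminus>\<^sup>1\<close> form \<open>w(a,b)\<^sup>p\<close>; in \<open>w(a,w(b,c))\<close> they form \<open>a\<^sup>p\<close> followed by a power of \<open>b\<close>.
\<close>

lemma associative_word_first_generator:
  fixes w :: "letter list"
  defines "F \<equiv> free_group 3"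
  defines "W \<equiv> word_val2 F w"
  assumes w: "w \<in> carrier (free_group 2)" "w \<noteq> []" "fst (hd w) = 0"
    and expo: "expo 0 w = 1" "expo 1 w = 1"
    and assoc: "W (W (gen 0) (gen 1)) (gen 2) = W (gen 0) (W (gen 1) (gen 2))"
  shows "w = [(0, True), (1, True)]"
proof -
  interpret F: group F unfolding F_def by (rule group_free_group)
  have gens: "gen 0 \<in> carrier F" "gen 1 \<in> carrier F" "gen 2 \<in> carrier F"
    by (simp_all add: F_def gen_in_carrier)
  have w01: "reduced w" "fst ` set w \<subseteq> {0, 1}"
    using w(1) by (auto simp: carrier_free_group less_2_cases_iff)
  then have w10: "fst ` set w \<subseteq> {1, 0}" and w2: "fst ` set w \<subseteq> {..<2}" by auto
  have wF: "w \<in> carrier F"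
    using w01 by (auto simp: F_def carrier_free_group)
  define U where "U = W (gen 1) (gen 2)"
  have UH: "U \<in> {xs \<in> carrier F. fst ` set xs \<subseteq> {1, 2}}"
    unfolding U_def W_def word_val2_def F_def using gens
    by (intro group.word_val_in_subgroup[OF group_free_group] subgroup_words_over)
      (auto simp: F_def gen_def)
  then have U: "U \<in> carrier F" "0 \<notin> fst ` set U" by auto
  \<comment> \<open>The exponent sum of \<open>U = w(b,c)\<close> at \<open>c\<close> will show that
    every nonzero power of \<open>U\<close> contains \<open>c\<close>.\<close>
  have U2: "expo 2 U = 1"
    unfolding U_def W_def F_def using expo w2 gens
    by (subst expo_word_val2) (auto simp: F_def gen_def expo_Cons letter_sign_def)
  have Wab: "W (gen 0) (gen 1) = w"
  proof -
    have "W (gen 0) (gen 1) = word_val F gen w"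
      unfolding W_def word_val2_def using w01(2) by (intro word_val_cong) auto
    then show ?thesis using word_val_gen wF by (simp add: F_def)
  qed
  \<comment> \<open>The substitutions for the two sides of associativity: \<open>f\<close> sends
    \<open>a, b\<close> to \<open>w(a,b), c\<close>, and \<open>g\<close> sends them to
    \<open>a, w(b,c)\<close>.\<close>
  define f g where "f = (\<lambda>i::nat. if i = 0 then w else gen 2)"
    and "g = (\<lambda>i::nat. if i = 0 then gen 0 else U)"
  have LR: "word_val F f w = word_val F g w"
    using assoc unfolding Wab U_def[symmetric] by (simp add: W_def word_val2_def f_def g_def)

  define P D where "P = takeWhile (\<lambda>x. fst x \<noteq> 1) w" and "D = dropWhile (\<lambda>x. fst x \<noteq> 1) w"
  have PD: "w = P @ D" by (simp add: P_def D_def)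
  obtain m s where P: "P = replicate m (0, s)"
    unfolding P_def using takeWhile_eq_replicate[OF w01(1) w10] by blast
  have "P \<noteq> []"
    using w(2,3) by (cases w) (auto simp: P_def)
  then have m: "m \<ge> 1"
    using P by (cases m) auto
  have D: "D \<noteq> []" "fst (hd D) = 1"
  proof -
    have "1 \<in> fst ` set w"
      using expo(2) expo_not_occurring[of 1 w] by (metis zero_neq_one)
    then show "D \<noteq> []"
      by (force simp: D_def dropWhile_eq_Nil_conv)
    then show "fst (hd D) = 1"
      using hd_dropWhile[of "\<lambda>x. fst x \<noteq> 1" w] by (simp add: D_def)
  qed
  have Dr: "reduced D" "fst ` set D \<subseteq> {0, 1}"
    using w01 PD by (auto simp: reduced_append)

  define p where "p = letter_sign (0, s) * int m"
  have f01: "f 1 = gen 2" "f 0 = w" "2 < (3::nat)" "2 \<notin> fst ` set w" "expo 0 w \<noteq> 0"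
    using w01(2) expo(1) by (auto simp: f_def)
  \<comment> \<open>The marking generator is \<open>c\<close>, and the word substituted for
    \<open>a\<close> is \<open>w\<close> itself, with exponent sum 1 at \<open>a\<close>.\<close>
  note nf = word_val_normal_form[of f 1 2 0 w 3 0 w, folded F_def P_def D_def,
      OF f01(1-3) wF f01(4,5) w01(1) w10]
  have L: "word_val F f w = w [^]\<^bsub>F\<^esub> p @ word_val F f D"
    using nf(1) by (simp add: P p_def expo_replicate)
  have L': "word_val F f D \<noteq> []" "fst (hd (word_val F f D)) = 2"
    using nf(2)[OF D(1)] by simp_all
  have "2 \<notin> fst ` set (w [^]\<^bsub>F\<^esub> p)"
    using F.subgroup_int_pow_closed[OF subgroup_words_over[of 3 "{0, 1}", folded F_def], of w p] wF w01
    by auto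
  then have takeL: "takeWhile (\<lambda>x. fst x \<noteq> 2) (word_val F f w) = w [^]\<^bsub>F\<^esub> p"
    unfolding L using L' by (subst takeWhile_append2) (auto simp: takeWhile_eq_Nil_iff)

  \<comment> \<open>The exponent of the first \<open>b\<close>-syllable of \<open>w\<close>. As it
    is nonzero, \<open>U^q\<close> contains \<open>c\<close>, so the first \<open>c\<close>-letter
    on the right-hand side lies in \<open>U^q\<close>.\<close>
  define q where "q = expo 1 (takeWhile (\<lambda>x. fst x \<noteq> 0) D)"
  define E where "E = dropWhile (\<lambda>x. fst x \<noteq> 0) D"
  have "q \<noteq> 0"
  proof -
    obtain m' s' where 1: "takeWhile (\<lambda>x. fst x \<noteq> 0) D = replicate m' (1, s')"
      using takeWhile_eq_replicate[OF Dr] by blast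
    moreover have "takeWhile (\<lambda>x. fst x \<noteq> 0) D \<noteq> []"
      using D by (cases D) auto
    ultimately show ?thesis by (simp add: q_def expo_replicate letter_sign_def)
  qed
  have gD: "word_val F g D = U [^]\<^bsub>F\<^esub> q @ word_val F g E"
    using word_val_normal_form(1)[of g 0 0 1 U 3 2 D] U U2 Dr
    by (simp add: g_def F_def q_def E_def)
  have Uq: "U [^]\<^bsub>F\<^esub> q \<in> carrier F" "fst ` set (U [^]\<^bsub>F\<^esub> q) \<subseteq> {1, 2}"
    using F.subgroup_int_pow_closed[OF subgroup_words_over[of 3 "{1, 2}", folded F_def], of U q] UH
    by auto
  have "expo 2 (U [^]\<^bsub>F\<^esub> q) \<noteq> 0"
    using expo_int_pow[of U 3 2 q] U U2 \<open>q \<noteq> 0\<close> by (simp add: F_def)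
  then have Uq2: "2 \<in> fst ` set (U [^]\<^bsub>F\<^esub> q)"
    using expo_not_occurring by blast
  then have "U [^]\<^bsub>F\<^esub> q \<noteq> []" by auto
  have gc: "g i \<in> carrier F" for i using gens U by (simp add: g_def)
  have gDc: "word_val F g D \<in> carrier F"
    using gc by (intro F.word_val_closed) auto
  have "word_val F g P = P"
  proof -
    have "word_val F g P = word_val F gen P"
      unfolding P by (rule word_val_cong) (simp add: g_def)
    moreover have "P \<in> carrier F"
      using wF PD by (auto simp: F_def carrier_free_group reduced_append)
    ultimately show ?thesis using word_val_gen by (simp add: F_def)
  qed
  then have "word_val F g w = P \<otimes>\<^bsub>F\<^esub> word_val F g D"
    using gc by (subst PD, subst F.word_val_append) auto
  \<comment> \<open>\<open>P\<close> is a power of \<open>a\<close>, and the other factor begins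
    with a letter of \<open>U^q\<close>, which is \<open>b\<close> or \<open>c\<close> up to sign;
    nothing cancels.\<close>
  also have "\<dots> = P @ word_val F g D"
  proof -
    have "hd (word_val F g D) \<in> set (U [^]\<^bsub>F\<^esub> q)"
      using \<open>U [^]\<^bsub>F\<^esub> q \<noteq> []\<close> by (simp add: gD)
    then have "fst (hd (word_val F g D)) \<noteq> 0"
      using Uq(2) by force
    moreover have "last P = (0, s)" "reduced P"
      using m w01(1) PD P by (auto simp: reduced_append)
    ultimately have "reduced (P @ word_val F g D)"
      using gDc by (auto simp: reduced_append F_def carrier_free_group letter_inv_def)
    then show ?thesis by (simp add: F_def mult_free_group_append)
  qed
  finally have R: "word_val F g w = P @ U [^]\<^bsub>F\<^esub> q @ word_val F g E"
    by (simp add: gD)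
  \<comment> \<open>The part of \<open>U^q\<close> before its first \<open>c\<close>-letter is a
    reduced word in \<open>b\<close> alone, hence a power of \<open>b\<close>.\<close>
  define B where "B = takeWhile (\<lambda>x. fst x \<noteq> 2) (U [^]\<^bsub>F\<^esub> q)"
  have takeR: "takeWhile (\<lambda>x. fst x \<noteq> 2) (word_val F g w) = P @ B"
  proof -
    obtain x where "x \<in> set (U [^]\<^bsub>F\<^esub> q)" "\<not> fst x \<noteq> 2" using Uq2 by auto
    then have "takeWhile (\<lambda>x. fst x \<noteq> 2) (U [^]\<^bsub>F\<^esub> q @ word_val F g E) = B"
      unfolding B_def by (rule takeWhile_append1)
    then show ?thesis
      unfolding R by (subst takeWhile_append2) (auto simp: P)
  qed
  have "reduced (U [^]\<^bsub>F\<^esub> q)" "fst ` set (U [^]\<^bsub>F\<^esub> q) \<subseteq> {2, 1}"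
    using Uq by (auto simp: F_def carrier_free_group)
  then obtain k t where B: "B = replicate k (1, t)"
    unfolding B_def using takeWhile_eq_replicate by blast

  have eq: "w [^]\<^bsub>F\<^esub> (letter_sign (0, s) * int m) = replicate m (0, s) @ B"
    using takeL takeR LR by (simp add: p_def P)
  have "m = 1"
    by (rule power_eq_first_generator_power[OF _ expo(2) m _ eq[unfolded F_def]])
      (use wF in \<open>auto simp: F_def B\<close>)
  show ?thesis
  proof (cases s)
    case True
    then have 1: "w = (0, True) # replicate k (1, t)"
      using eq \<open>m = 1\<close> wF by (simp add: letter_sign_def B)
    then have "letter_sign (1, t) * int k = 1"
      using expo(2) expo_replicate[of 1 k t] by (simp add: expo_Cons)
    then have "t" "k = 1" by (auto simp: letter_sign_def split: if_splits)
    then show ?thesis using 1 by simp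
  next
    \<comment> \<open>Here \<open>p = -1\<close> and \<open>w^-1\<close> is \<open>a^-1\<close>
      followed by a nontrivial power of \<open>b\<close>. Then \<open>w\<close> starts with a
      \<open>b\<close>-letter, contrary to the choice of the first generator.\<close>
    case False
    then have 1: "inv\<^bsub>F\<^esub> w = (0, False) # replicate k (1, t)"
      using eq \<open>m = 1\<close> wF F.int_pow_neg[of w 1] by (simp add: letter_sign_def B)
    moreover have "expo 1 (inv\<^bsub>F\<^esub> w) = - 1"
      using expo_inv[of w 3 1] wF expo by (simp add: F_def)
    ultimately have "k \<noteq> 0" by (cases k) (auto simp: expo_Cons)
    have "w = inv\<^bsub>F\<^esub> (inv\<^bsub>F\<^esub> w)" using wF by simp
    also have "\<dots> = rev (map letter_inv (inv\<^bsub>F\<^esub> w))"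
      using inv_free_group[of "inv\<^bsub>F\<^esub> w" 3] wF F.inv_closed by (simp add: F_def)
    also have "\<dots> = replicate k (letter_inv (1, t)) @ [letter_inv (0, False)]"
      unfolding 1 by simp
    finally have "fst (hd w) = 1"
      using \<open>k \<noteq> 0\<close> by (cases k) (auto simp: letter_inv_def)
    then show ?thesis using w(3) by simp
  qed
qed

section \<open>Exchanging the two generators\<close>

definition flip :: "letter \<Rightarrow> letter" where
  "flip x = (1 - fst x, snd x)"

lemma word_val2_map_flip:
  "fst ` set w \<subseteq> {..<2} \<Longrightarrow> word_val2 G (map flip w) x y = word_val2 G w y x"
proof (induction w)
  case (Cons z w)
  then show ?case
    using less_2_cases[of "fst z"] by (auto simp: word_val2_def word_val_def letter_val_def flip_def)
qed (simp add: word_val2_def word_val_def)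

lemma expo_map_flip:
  assumes "fst ` set w \<subseteq> {..<2}"
  shows "expo 0 (map flip w) = expo 1 w" "expo 1 (map flip w) = expo 0 w"
proof -
  have "expo 0 (map flip w) = expo 1 w \<and> expo 1 (map flip w) = expo 0 w"
    using assms
  proof (induction w)
    case (Cons z w)
    then show ?case
      using less_2_cases[of "fst z"] by (auto simp: expo_Cons letter_sign_def flip_def)
  qed simp
  then show "expo 0 (map flip w) = expo 1 w" "expo 1 (map flip w) = expo 0 w" by auto
qed

text \<open>The bound matters because subtraction on naturals truncates: \<open>flip\<close> sends
  every index above 1 to 0.\<close>

lemma flip_flip: "fst x < 2 \<Longrightarrow> flip (flip x) = x"
  by (cases x) (auto simp: flip_def)

lemma map_flip_in_carrier:
  assumes "w \<in> carrier (free_group 2)"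
  shows "map flip w \<in> carrier (free_group 2)"
proof -
  have "successively (\<lambda>x y. y \<noteq> letter_inv x) w"
    using assms by (simp add: carrier_free_group reduced_def)
  moreover have "flip y \<noteq> letter_inv (flip x)"
    if "x \<in> set w" "y \<in> set w" "y \<noteq> letter_inv x" for x y
  proof -
    have "fst x < 2" "fst y < 2"
      using that assms by (auto simp: carrier_free_group)
    then have "1 - fst y = 1 - fst x \<longleftrightarrow> fst y = fst x" by arith
    then show ?thesis
      using that(3) by (auto simp: flip_def letter_inv_def prod_eq_iff)
  qed
  ultimately have "reduced (map flip w)"
    unfolding reduced_def successively_map by (rule successively_mono)
  then show ?thesis by (auto simp: carrier_free_group flip_def)
qed

text \<open>Exchanging \<open>a\<close> and \<open>b\<close> replaces the operation by its opposite,
  which is again associative. This reduces a word starting with \<open>b\<close> to one starting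
  with \<open>a\<close>.\<close>

lemma associative_word:
  fixes w :: "letter list"
  defines "F \<equiv> free_group 3"
  defines "W \<equiv> word_val2 F w"
  assumes w: "w \<in> carrier (free_group 2)" and expo: "expo 0 w = 1" "expo 1 w = 1"
    and assoc: "\<And>x y z. x \<in> carrier F \<Longrightarrow> y \<in> carrier F \<Longrightarrow> z \<in> carrier F \<Longrightarrow>
      W (W x y) z = W x (W y z)"
  shows "w = [(0, True), (1, True)] \<or> w = [(1, True), (0, True)]"
proof -
  have gens: "gen 0 \<in> carrier F" "gen 1 \<in> carrier F" "gen 2 \<in> carrier F"
    by (simp_all add: F_def gen_in_carrier)
  have w2: "fst ` set w \<subseteq> {..<2}" using w by (simp add: carrier_free_group)
  have "w \<noteq> []" using expo by auto
  then have "fst (hd w) < 2" using w2 by (cases w) auto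
  then consider "fst (hd w) = 0" | "fst (hd w) = 1" by linarith
  then show ?thesis
  proof cases
    case 1
    with w \<open>w \<noteq> []\<close> expo assoc gens have "w = [(0, True), (1, True)]"
      unfolding W_def F_def by (intro associative_word_first_generator) simp_all
    then show ?thesis ..
  next
    case 2
    note flip = word_val2_map_flip[OF w2]
    have "map flip w = [(0, True), (1, True)]"
    proof (rule associative_word_first_generator)
      show "fst (hd (map flip w)) = 0"
        using 2 \<open>w \<noteq> []\<close> by (simp add: hd_map flip_def)
    qed (use w \<open>w \<noteq> []\<close> expo assoc gens w2 in
        \<open>simp_all add: map_flip_in_carrier expo_map_flip expo_map_flip(2)[unfolded One_nat_def] flip W_def F_def\<close>)
    then have "map flip (map flip w) = [(1, True), (0, True)]"
      by (simp add: flip_def)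
    moreover have "map flip (map flip w) = w"
      using w2 by (auto simp: flip_flip intro!: map_idI)
    ultimately show ?thesis by simp
  qed
qed


section \<open>Words defining group operations\<close>

lemma (in group) group_with_operation:
  assumes "\<And>x y. x \<in> carrier G \<Longrightarrow> y \<in> carrier G \<Longrightarrow> f x y = x \<otimes> y"
  shows "group \<lparr>carrier = carrier G, monoid.mult = f, one = \<one>\<rparr>"
proof (rule groupI)
  fix x assume "x \<in> carrier \<lparr>carrier = carrier G, monoid.mult = f, one = \<one>\<rparr>"
  then show "\<exists>y\<in>carrier \<lparr>carrier = carrier G, monoid.mult = f, one = \<one>\<rparr>.
      y \<otimes>\<^bsub>\<lparr>carrier = carrier G, monoid.mult = f, one = \<one>\<rparr>\<^esub> x =
      \<one>\<^bsub>\<lparr>carrier = carrier G, monoid.mult = f, one = \<one>\<rparr>\<^esub>"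
    by (intro bexI[of _ "inv x"]) (simp_all add: assms)
qed (simp_all add: assms m_assoc)

lemma (in group) group_with_opposite_operation:
  assumes "\<And>x y. x \<in> carrier G \<Longrightarrow> y \<in> carrier G \<Longrightarrow> f x y = y \<otimes> x"
  shows "group \<lparr>carrier = carrier G, monoid.mult = f, one = \<one>\<rparr>"
proof (rule groupI)
  fix x assume "x \<in> carrier \<lparr>carrier = carrier G, monoid.mult = f, one = \<one>\<rparr>"
  then show "\<exists>y\<in>carrier \<lparr>carrier = carrier G, monoid.mult = f, one = \<one>\<rparr>.
      y \<otimes>\<^bsub>\<lparr>carrier = carrier G, monoid.mult = f, one = \<one>\<rparr>\<^esub> x =
      \<one>\<^bsub>\<lparr>carrier = carrier G, monoid.mult = f, one = \<one>\<rparr>\<^esub>"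
    by (intro bexI[of _ "inv x"]) (simp_all add: assms)
qed (simp_all add: assms m_assoc)

lemma (in group) defines_group_operation_products:
  "defines_group_operation [(0, True), (1, True)] G"
  "defines_group_operation [(1, True), (0, True)] G"
  unfolding defines_group_operation_def
  by (intro exI[of _ \<one>] group_with_operation group_with_opposite_operation,
      simp add: word_val2_def letter_val_def)+

text \<open>Evaluation followed by the projection is a homomorphism with the right values on
  \<open>a\<close> and \<open>b\<close>, so uniqueness identifies it with evaluation in the
  quotient.\<close>

lemma (in normal) word_val2_FactGroup:
  assumes "w \<in> carrier (free_group 2)" "x \<in> carrier G" "y \<in> carrier G"
  shows "word_val2 (G Mod H) w (H #> x) (H #> y) = H #> word_val2 G w x y"
proof -
  interpret Q: group "G Mod H" by (rule factorgroup_is_group)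
  have "(\<lambda>w. H #> word_val2 G w x y) \<in> hom (free_group 2) (G Mod H)"
    using Group.hom_compose[OF word_val2_hom(1)[OF assms(2,3)] r_coset_hom_Mod] by (simp add: comp_def)
  then show ?thesis
    using assms word_val2_hom(2,3)[OF assms(2,3)]
    by (intro Q.word_val2_unique[symmetric]) simp_all
qed

lemma (in normal) rcoset_eq_imp_mult_inv_in:
  assumes "H #> x = H #> y" "x \<in> carrier G" "y \<in> carrier G"
  shows "x \<otimes> inv y \<in> H"
proof -
  have "x \<in> H #> y" using rcos_self[OF assms(2) is_subgroup] assms(1) by simp
  then show ?thesis using assms(3) by (auto simp: r_coset_def m_assoc mem_carrier)
qed

theorem mainTheorem6:
  fixes w :: "letter list"
  assumes "w \<in> carrier (free_group 2)"
  shows "(\<forall>n\<ge>2. \<forall>k\<ge>1.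
            defines_group_operation w (free_group n Mod lower_central (free_group n) k))
         \<longleftrightarrow> w = gen 0 \<otimes>\<^bsub>free_group 2\<^esub> gen 1 \<or> w = gen 1 \<otimes>\<^bsub>free_group 2\<^esub> gen 0"
proof -
  \<comment> \<open>Rank 3, to have a free generator for each variable of the associative
    law.\<close>
  let ?F = "free_group 3"
  interpret F: group ?F by (rule group_free_group)
  have gens: "gen 0 \<otimes>\<^bsub>free_group 2\<^esub> gen 1 = [(0, True), (1, True)]"
    "gen 1 \<otimes>\<^bsub>free_group 2\<^esub> gen 0 = [(1, True), (0, True)]"
    by (simp_all add: mult_free_group gen_in_carrier) (simp_all add: gen_def push_def letter_inv_def)
  show ?thesis
    unfolding gens
  proof (intro iffI allI impI)
    fix n k
    assume "w = [(0, True), (1, True)] \<or> w = [(1, True), (0, True)]"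
    moreover have "group (free_group n Mod lower_central (free_group n) k)"
      by (intro normal.factorgroup_is_group group.normal_lower_central group_free_group)
    ultimately show "defines_group_operation w (free_group n Mod lower_central (free_group n) k)"
      using group.defines_group_operation_products by blast
  next
    assume all: "\<forall>n\<ge>2. \<forall>k\<ge>1.
      defines_group_operation w (free_group n Mod lower_central (free_group n) k)"
    define W where "W = word_val2 ?F w"
    have Wc: "W x y \<in> carrier ?F" if "x \<in> carrier ?F" "y \<in> carrier ?F" for x y
      unfolding W_def word_val2_def using that by (intro F.word_val_closed) auto
    have op: "\<exists>e. group \<lparr>carrier = carrier (?F Mod lower_central ?F k),
        monoid.mult = word_val2 (?F Mod lower_central ?F k) w, one = e\<rparr>" if "k \<ge> 1" for k
      using all that unfolding defines_group_operation_def by simp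
    have coset: "lower_central ?F k #>\<^bsub>?F\<^esub> x \<in> carrier (?F Mod lower_central ?F k)"
      if "x \<in> carrier ?F" for x k
      using that by (auto simp: FactGroup_def RCOSETS_def)
    have Wcoset: "word_val2 (?F Mod lower_central ?F k) w
        (lower_central ?F k #>\<^bsub>?F\<^esub> x) (lower_central ?F k #>\<^bsub>?F\<^esub> y) = lower_central ?F k #>\<^bsub>?F\<^esub> W x y"
      if "x \<in> carrier ?F" "y \<in> carrier ?F" for x y k
      unfolding W_def using that assms
      by (intro normal.word_val2_FactGroup F.normal_lower_central)

    \<comment> \<open>\<open>e\<close> represents the neutral coset modulo the second term; the
      neutral laws hold there only up to cosets, which is enough for exponent sums.\<close>
    have "\<exists>e \<in> carrier ?F. \<forall>x \<in> carrier ?F. \<forall>i. expo i (W x e) = expo i x \<and> expo i (W e x) = expo i x"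
    proof -
      let ?N = "lower_central ?F 2"
      interpret N: normal ?N ?F by (rule F.normal_lower_central)
      obtain E where "group \<lparr>carrier = carrier (?F Mod ?N), monoid.mult = word_val2 (?F Mod ?N) w, one = E\<rparr>"
        using op[of 2] by auto
      then interpret Q: group "\<lparr>carrier = carrier (?F Mod ?N), monoid.mult = word_val2 (?F Mod ?N) w, one = E\<rparr>" .
      obtain e where e: "e \<in> carrier ?F" "E = ?N #>\<^bsub>?F\<^esub> e"
        using Q.one_closed by (auto simp: FactGroup_def RCOSETS_def)
      have cong: "expo i x = expo i y"
        if "?N #>\<^bsub>?F\<^esub> x = ?N #>\<^bsub>?F\<^esub> y" "x \<in> carrier ?F" "y \<in> carrier ?F" for x y i
        using expo_lower_central_2[OF N.rcoset_eq_imp_mult_inv_in[OF that], of i] that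
        by (simp add: expo_mult expo_inv)
      have "expo i (W x e) = expo i x \<and> expo i (W e x) = expo i x" if "x \<in> carrier ?F" for x i
        using that e Q.r_one[of "?N #>\<^bsub>?F\<^esub> x"] Q.l_one[of "?N #>\<^bsub>?F\<^esub> x"] coset[OF that, of 2]
        by (auto simp: Wcoset Wc intro!: cong)
      with e show ?thesis by blast
    qed
    then obtain e where e: "e \<in> carrier ?F"
      and expo_e: "\<And>x i. x \<in> carrier ?F \<Longrightarrow> expo i (W x e) = expo i x"
        "\<And>x i. x \<in> carrier ?F \<Longrightarrow> expo i (W e x) = expo i x" by blast
    have expo_W: "expo i (W x y) = expo 0 w * expo i x + expo 1 w * expo i y"
      if "x \<in> carrier ?F" "y \<in> carrier ?F" for x y i
      unfolding W_def using that assms by (intro expo_word_val2) (auto simp: carrier_free_group)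
    have g0: "gen 0 \<in> carrier ?F" "expo 0 (gen 0) = 1" "[] \<in> carrier ?F"
      by (simp_all add: gen_in_carrier) (simp_all add: gen_def expo_Cons letter_sign_def carrier_free_group)
    \<comment> \<open>Testing the neutral laws on the empty word removes the contribution of
      \<open>e\<close>; testing them on \<open>a\<close> then gives both exponent sums.\<close>
    have "expo 1 w * expo 0 e = 0" "expo 0 w * expo 0 e = 0"
      using expo_e[OF g0(3), of 0] expo_W[OF g0(3) e, of 0] expo_W[OF e g0(3), of 0] by simp_all
    then have expo: "expo 0 w = 1" "expo 1 w = 1"
      using expo_e[OF g0(1), of 0] expo_W[OF g0(1) e, of 0] expo_W[OF e g0(1), of 0] g0(2) by auto

    \<comment> \<open>The two sides agree modulo every term of the series, so
      \<open>W (W x y) z\<close> times the inverse of \<open>W x (W y z)\<close> lies in all of them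
      and is trivial.\<close>
    have "W (W x y) z = W x (W y z)"
      if xyz: "x \<in> carrier ?F" "y \<in> carrier ?F" "z \<in> carrier ?F" for x y z
    proof -
      have "W (W x y) z \<otimes>\<^bsub>?F\<^esub> inv\<^bsub>?F\<^esub> W x (W y z) \<in> lower_central ?F k" if k: "k \<ge> 1" for k
      proof -
        let ?N = "lower_central ?F k"
        interpret N: normal ?N ?F by (rule F.normal_lower_central)
        obtain E where "group \<lparr>carrier = carrier (?F Mod ?N), monoid.mult = word_val2 (?F Mod ?N) w, one = E\<rparr>"
          using op[OF k] by auto
        then interpret Q: group "\<lparr>carrier = carrier (?F Mod ?N), monoid.mult = word_val2 (?F Mod ?N) w, one = E\<rparr>" .
        have "?N #>\<^bsub>?F\<^esub> W (W x y) z = ?N #>\<^bsub>?F\<^esub> W x (W y z)"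
          using Q.m_assoc[of "?N #>\<^bsub>?F\<^esub> x" "?N #>\<^bsub>?F\<^esub> y" "?N #>\<^bsub>?F\<^esub> z"] xyz
          by (simp add: coset Wcoset Wc)
        then show ?thesis
          using xyz by (intro N.rcoset_eq_imp_mult_inv_in) (simp_all add: Wc)
      qed
      then have "W (W x y) z \<otimes>\<^bsub>?F\<^esub> inv\<^bsub>?F\<^esub> W x (W y z) = []"
        by (rule free_group_residually_nilpotent)
      then show ?thesis
        using xyz F.inv_solve_right'[of "[]" "W (W x y) z" "W x (W y z)"] F.one_closed
        by (simp add: Wc mult_free_group)
    qed
    then show "w = [(0, True), (1, True)] \<or> w = [(1, True), (0, True)]"
      using associative_word[OF assms expo] unfolding W_def by blast
  qed
qed

end
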